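(* Let $A\in\mathbb{R}^{m\times n}$ be semi-monotone, let $A=P_1-R_1+S_1$ be a double proper weak regular splitting and $A=P_2-R_2+S_2$ a double proper regular splitting of $A$. Suppose $N(R_2)\supseteq N(P_2)$, $R(R_2)\subseteq R(P_2)$, $-1\notin\sigma(R_2P_1^{\dagger})$ and $\widehat{\mathcal{A}}^{\dagger}\geq 0$, where $\widehat{\mathcal{A}}=(I+R_2P_1^{\dagger})A$. If $P_1^{\dagger}R_1\geq P_2^{\dagger}R_2$, $P_2^{\dagger}S_2\geq P_1^{\dagger}S_1$ and $P_2^{\dagger}R_2+P_2^{\dagger}S_2\leq 0$, then $\rho(\mathcal{W}_{12})\leq\min\{\rho(T_1),\rho(T_2)\}<1$, where $$\mathcal{W}_{12}=\begin{pmatrix} P_2^{\dagger}R_2P_1^{\dagger}R_1-P_2^{\dagger}S_2 & -P_2^{\dagger}R_2P_1^{\dagger}S_1\\ I & 0\end{pmatrix},\qquad T_i=\begin{pmatrix} P_i^{\dagger}R_i & -P_i^{\dagger}S_i\\ I&0\end{pmatrix}\ (i=1,2).$$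
   Context: For $M\in\mathbb{R}^{m\times n}$, $M^{\dagger}$ is its Moore–Penrose inverse, $R(M)$, $N(M)$ its range and null space; inequalities are entrywise; $\rho$ is the spectral radius, $\sigma$ the spectrum. $A$ is semi-monotone if $A^{\dagger}\geq0$. A double splitting $A=P-R+S$ is a double proper splitting if $R(P)=R(A)$ and $N(P)=N(A)$; it is double proper regular if moreover $P^{\dagger}\geq0$, $R\geq0$, $S\leq0$; double proper weak regular if moreover $P^{\dagger}\geq 0$, $P^{\dagger}R\geq 0$, $P^{\dagger}S\leq 0$. *)

theory Defs
  imports "Jordan_Normal_Form.Spectral_Radius"
begin

definition mp_inv :: "real mat \<Rightarrow> real mat" where
  "mp_inv A = (THE X. X \<in> carrier_mat (dim_col A) (dim_row A) \<and>
      A * X * A = A \<and> X * A * X = X \<and>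
      transpose_mat (A * X) = A * X \<and> transpose_mat (X * A) = X * A)"

definition range_mat :: "real mat \<Rightarrow> real vec set" where
  "range_mat A = {A *\<^sub>v x | x. x \<in> carrier_vec (dim_col A)}"

definition null_mat :: "real mat \<Rightarrow> real vec set" where
  "null_mat A = {x \<in> carrier_vec (dim_col A). A *\<^sub>v x = 0\<^sub>v (dim_row A)}"

definition mat_le :: "real mat \<Rightarrow> real mat \<Rightarrow> bool" where
  "mat_le B C = (dim_row B = dim_row C \<and> dim_col B = dim_col C \<and>
      (\<forall>i < dim_row B. \<forall>j < dim_col B. B $$ (i,j) \<le> C $$ (i,j)))"

definition semi_monotone :: "real mat \<Rightarrow> bool" where
  "semi_monotone A = mat_le (0\<^sub>m (dim_col A) (dim_row A)) (mp_inv A)"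

definition double_proper_splitting :: "real mat \<Rightarrow> real mat \<Rightarrow> real mat \<Rightarrow> real mat \<Rightarrow> bool" where
  "double_proper_splitting A P R S =
     (P \<in> carrier_mat (dim_row A) (dim_col A) \<and> R \<in> carrier_mat (dim_row A) (dim_col A) \<and>
      S \<in> carrier_mat (dim_row A) (dim_col A) \<and> A = P - R + S \<and>
      range_mat P = range_mat A \<and> null_mat P = null_mat A)"

definition double_proper_regular :: "real mat \<Rightarrow> real mat \<Rightarrow> real mat \<Rightarrow> real mat \<Rightarrow> bool" where
  "double_proper_regular A P R S =
     (double_proper_splitting A P R S \<and>
      mat_le (0\<^sub>m (dim_col A) (dim_row A)) (mp_inv P) \<and>
      mat_le (0\<^sub>m (dim_row A) (dim_col A)) R \<and>
      mat_le S (0\<^sub>m (dim_row A) (dim_col A)))"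

definition double_proper_weak_regular :: "real mat \<Rightarrow> real mat \<Rightarrow> real mat \<Rightarrow> real mat \<Rightarrow> bool" where
  "double_proper_weak_regular A P R S =
     (double_proper_splitting A P R S \<and>
      mat_le (0\<^sub>m (dim_col A) (dim_row A)) (mp_inv P) \<and>
      mat_le (0\<^sub>m (dim_col A) (dim_col A)) (mp_inv P * R) \<and>
      mat_le (mp_inv P * S) (0\<^sub>m (dim_col A) (dim_col A)))"

definition rspectrum :: "real mat \<Rightarrow> complex set" where
  "rspectrum M = spectrum (map_mat complex_of_real M)"

definition rho :: "real mat \<Rightarrow> real" where
  "rho M = spectral_radius (map_mat complex_of_real M)"

end

theory Submission
  imports Defs
begin

text \<open>Write \<open>ai = Pi\<^sup>+ Ri\<close> and \<open>bi = - Pi\<^sup>+ Si\<close>, where the superscript denotes the Moore--Penrose inverse;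
  these four matrices are nonnegative, and the blocks of \<open>W12\<close> are \<open>a2 a1 + b2\<close> and \<open>a2 b1\<close>.
  All spectral radii are bounded by exhibiting a vector \<open>x \<ge> 0\<close> with \<open>s C x + D x \<le> s\<^sup>2 x\<close> for the
  companion matrix with upper blocks \<open>C\<close>, \<open>D\<close>; such an \<open>x\<close> suffices as soon as it dominates the images
  of \<open>C\<close> and \<open>D\<close>, so no Perron vector is required.

  For \<open>\<rho>(T2) < s < 1\<close> let \<open>x \<ge> 0\<close> solve \<open>s\<^sup>2 x = s a2 x + b2 x + P2\<^sup>+ e\<close>, where \<open>e\<close> is the all-ones vector.
  Multiplying by \<open>P1\<^sup>+ P2\<close> gives
  \<open>s\<^sup>2 P1\<^sup>+ A x = (s - s\<^sup>2) P1\<^sup>+ R2 x - (1 - s\<^sup>2) P1\<^sup>+ S2 x + P1\<^sup>+ e \<ge> 0\<close>, hence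
  \<open>a2 (x - a1 x - b1 x) = a2 P1\<^sup>+ A x \<ge> 0\<close>. Together with \<open>a2 \<le> b2\<close> this yields
  \<open>s (a2 a1 + b2) x + a2 b1 x \<le> s\<^sup>2 x\<close>, and therefore \<open>\<rho>(W12) \<le> s\<close>. Since \<open>a2 \<le> a1\<close> and \<open>b2 \<le> b1\<close>,
  also \<open>\<rho>(T2) \<le> \<rho>(T1)\<close>, so the minimum is \<open>\<rho>(T2)\<close>; that it is below 1 follows from \<open>x = A\<^sup>+ e\<close>.\<close>

section \<open>Spectral radius of nonnegative matrices\<close>

lemma mult_mat_vec_uminus:
  fixes X :: "'a :: ring mat"
  assumes "X \<in> carrier_mat m n" "v \<in> carrier_vec n"
  shows "X *\<^sub>v - v = - (X *\<^sub>v v)"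
  using assms by (intro eq_vecI) auto

lemma mult_mat_vec_mono:
  fixes A :: "real mat"
  assumes "A \<in> carrier_mat nr nc" "0\<^sub>m nr nc \<le> A" "y \<in> carrier_vec nc" "x \<le> y"
  shows "A *\<^sub>v x \<le> A *\<^sub>v y"
  using assms unfolding less_eq_vec_def less_eq_mat_def
  by (auto simp: scalar_prod_def intro!: sum_mono mult_left_mono)

lemma mult_mat_vec_mono_left:
  fixes A B :: "real mat"
  assumes "B \<in> carrier_mat nr nc" "A \<le> B" "x \<in> carrier_vec nc" "0\<^sub>v nc \<le> x"
  shows "A *\<^sub>v x \<le> B *\<^sub>v x"
  using assms unfolding less_eq_vec_def less_eq_mat_def
  by (auto simp: scalar_prod_def intro!: sum_mono mult_right_mono)

lemma mult_mat_vec_nonneg: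
  fixes A :: "real mat"
  assumes "A \<in> carrier_mat nr nc" "0\<^sub>m nr nc \<le> A" "x \<in> carrier_vec nc" "0\<^sub>v nc \<le> x"
  shows "0\<^sub>v nr \<le> A *\<^sub>v x"
proof -
  have "A *\<^sub>v 0\<^sub>v nc = 0\<^sub>v nr"
    using assms(1) by (intro eq_vecI) auto
  then show ?thesis
    using mult_mat_vec_mono[OF assms] by simp
qed

lemma mult_mat_nonneg:
  fixes A B :: "real mat"
  assumes "A \<in> carrier_mat n k" "B \<in> carrier_mat k m" "0\<^sub>m n k \<le> A" "0\<^sub>m k m \<le> B"
  shows "0\<^sub>m n m \<le> A * B"
  using assms unfolding less_eq_mat_def
  by (auto simp: scalar_prod_def intro!: sum_nonneg)

section \<open>Eigenvectors and the spectral radius\<close>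

lemma rho_eigenvector:
  assumes M: "M \<in> carrier_mat N N" and N: "N > 0"
  obtains l z where "z \<in> carrier_vec N" "z \<noteq> 0\<^sub>v N" "norm l = rho M"
    "map_mat complex_of_real M *\<^sub>v z = l \<cdot>\<^sub>v z"
proof -
  have "map_mat complex_of_real M \<in> carrier_mat N N"
    using M by simp
  from spectral_radius_mem_max(1)[OF this N] show ?thesis
    using M that unfolding rho_def spectrum_def eigenvalue_def eigenvector_def
    by auto
qed

lemma norm_le_rho:
  assumes M: "M \<in> carrier_mat N N"
    and z: "z \<in> carrier_vec N" "z \<noteq> 0\<^sub>v N" "map_mat complex_of_real M *\<^sub>v z = l \<cdot>\<^sub>v z"
  shows "norm l \<le> rho M"
proof -
  have C: "map_mat complex_of_real M \<in> carrier_mat N N"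
    using M by simp
  have "eigenvalue (map_mat complex_of_real M) l"
    using z M unfolding eigenvalue_def eigenvector_def by auto
  moreover have "N > 0"
    using z by (cases "N = 0") auto
  ultimately show ?thesis
    unfolding rho_def by (intro spectral_radius_mem_max(2)[OF C]) (auto simp: spectrum_def)
qed

lemma rho_nonneg:
  assumes "M \<in> carrier_mat N N" "N > 0"
  shows "0 \<le> rho M"
  using rho_eigenvector[OF assms] by (metis norm_ge_zero)

text \<open>The subinvariant vector need not be positive: domination of the image of the squared matrix
  replaces irreducibility. For an eigenvector for a value of modulus \<open>r > s\<close> with entrywise modulus \<open>w\<close>,
  a bound \<open>w \<le> c x\<close> improves itself to \<open>w \<le> (s / r) c x\<close>.\<close>

lemma rho_le_if_subinvariant:
  assumes M: "M \<in> carrier_mat N N" and N: "N > 0" and M0: "0\<^sub>m N N \<le> M"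
    and x: "x \<in> carrier_vec N" "0\<^sub>v N \<le> x"
    and s: "0 \<le> s" and sub: "M *\<^sub>v x \<le> s \<cdot>\<^sub>v x"
    and dom: "\<And>w. w \<in> carrier_vec N \<Longrightarrow> 0\<^sub>v N \<le> w \<Longrightarrow> \<exists>t. M *\<^sub>v (M *\<^sub>v w) \<le> t \<cdot>\<^sub>v x"
  shows "rho M \<le> s"
proof (rule ccontr)
  assume "\<not> rho M \<le> s"
  obtain l z where z: "z \<in> carrier_vec N" "z \<noteq> 0\<^sub>v N" and l: "norm l = rho M"
    and ev: "map_mat complex_of_real M *\<^sub>v z = l \<cdot>\<^sub>v z"
    using rho_eigenvector[OF M N] .
  define r where "r = norm l"
  have r: "r > s" "r > 0"
    using \<open>\<not> rho M \<le> s\<close> l s unfolding r_def by auto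
  define w where "w = map_vec norm z"
  have w: "w \<in> carrier_vec N" "0\<^sub>v N \<le> w"
    using z unfolding w_def less_eq_vec_def by auto
  have Mw: "M *\<^sub>v w \<in> carrier_vec N"
    by (rule mult_mat_vec_carrier[OF M w(1)])
  \<comment> \<open>Moduli are taken in the eigenvector equation; the triangle inequality applies,
    and the nonnegative entries of \<open>M\<close> pass through the norm.\<close>
  have up: "r \<cdot>\<^sub>v w \<le> M *\<^sub>v w"
    unfolding less_eq_vec_def
  proof (intro conjI allI impI)
    fix i assume "i < dim_vec (M *\<^sub>v w)"
    then have i: "i < N"
      using M by simp
    have "r * norm (z $ i) = norm ((map_mat complex_of_real M *\<^sub>v z) $ i)"
      using ev i z by (simp add: r_def norm_mult)
    also have "\<dots> = norm (\<Sum>j = 0..<N. of_real (M $$ (i,j)) * z $ j)"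
      using i z M by (simp add: scalar_prod_def)
    also have "\<dots> \<le> (\<Sum>j = 0..<N. norm (of_real (M $$ (i,j)) * z $ j))"
      by (rule norm_sum)
    also have "\<dots> = (\<Sum>j = 0..<N. M $$ (i,j) * w $ j)"
      using M M0 i z by (intro sum.cong) (auto simp: norm_mult w_def less_eq_mat_def)
    also have "\<dots> = (M *\<^sub>v w) $ i"
      using i w M by (simp add: scalar_prod_def)
    finally show "(r \<cdot>\<^sub>v w) $ i \<le> (M *\<^sub>v w) $ i"
      using i z by (simp add: w_def)
  qed (use M w in simp)
  obtain t where t: "M *\<^sub>v (M *\<^sub>v w) \<le> t \<cdot>\<^sub>v x"
    using dom[OF w] by blast
  \<comment> \<open>This constant comes from \<open>r^2 w \<le> M (M w) \<le> t x\<close>. The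
    maximum with 0 keeps it nonnegative, so that \<open>M x \<le> s x\<close> may be scaled by it in
    the iteration.\<close>
  define c where "c = max t 0 / r\<^sup>2"
  have up2: "r \<cdot>\<^sub>v (M *\<^sub>v w) \<le> M *\<^sub>v (M *\<^sub>v w)"
    using mult_mat_vec_mono[OF M M0 Mw up] M w by (simp add: mult_mat_vec)
  have base: "w $ i \<le> c * x $ i" if i: "i < N" for i
  proof -
    have "r * (r * w $ i) \<le> r * (M *\<^sub>v w) $ i"
      using up i r w M unfolding less_eq_vec_def by (intro mult_left_mono) auto
    also have "\<dots> \<le> (M *\<^sub>v (M *\<^sub>v w)) $ i"
      using up2 i M unfolding less_eq_vec_def by auto
    also have "\<dots> \<le> t * x $ i"
      using t i M x unfolding less_eq_vec_def by auto
    also have "\<dots> \<le> max t 0 * x $ i"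
      using x i unfolding less_eq_vec_def by (intro mult_right_mono) auto
    finally show ?thesis
      using r by (simp add: c_def field_simps power2_eq_square)
  qed
  have c: "c \<ge> 0"
    unfolding c_def by simp
  have iter: "w \<le> ((s / r) ^ k * c) \<cdot>\<^sub>v x" for k
  proof (induction k)
    case 0
    show ?case
      using base w x unfolding less_eq_vec_def by auto
  next
    case (Suc k)
    let ?a = "(s / r) ^ k * c"
    have a: "?a \<ge> 0"
      using s r c by simp
    have ax: "?a \<cdot>\<^sub>v x \<in> carrier_vec N"
      using x by simp
    have "M *\<^sub>v w \<le> ?a \<cdot>\<^sub>v (M *\<^sub>v x)"
      using mult_mat_vec_mono[OF M M0 ax Suc] M x by (simp add: mult_mat_vec)
    then have 1: "r \<cdot>\<^sub>v w \<le> ?a \<cdot>\<^sub>v (M *\<^sub>v x)"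
      using up by (rule order_trans[rotated])
    show ?case
      unfolding less_eq_vec_def
    proof (intro conjI allI impI)
      fix i assume "i < dim_vec (((s / r) ^ Suc k * c) \<cdot>\<^sub>v x)"
      then have i: "i < N"
        using x by simp
      have "r * w $ i \<le> ?a * (M *\<^sub>v x) $ i"
        using 1 i M w unfolding less_eq_vec_def by auto
      also have "\<dots> \<le> ?a * (s * x $ i)"
        using sub a i M x unfolding less_eq_vec_def by (intro mult_left_mono) auto
      finally have "w $ i \<le> ?a * (s * x $ i) / r"
        using r by (simp add: pos_le_divide_eq mult.commute)
      then show "w $ i \<le> (((s / r) ^ Suc k * c) \<cdot>\<^sub>v x) $ i"
        using i x by (simp add: mult_ac)
    qed (use x w in simp)
  qed
  \<comment> \<open>Since \<open>s < r\<close>, the bounds on \<open>w $ i\<close> shrink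
    geometrically to 0, which would make the eigenvector vanish.\<close>
  have "z $ i = 0" if i: "i < N" for i
  proof -
    have "(\<lambda>k. (s / r) ^ k * c * x $ i) \<longlonglongrightarrow> 0 * c * x $ i"
      using s r by (intro tendsto_intros LIMSEQ_realpow_zero) auto
    moreover have "w $ i \<le> (s / r) ^ k * c * x $ i" for k
      using iter[of k] i x unfolding less_eq_vec_def by auto
    ultimately have "w $ i \<le> 0 * c * x $ i"
      by (intro LIMSEQ_le_const) auto
    then show ?thesis
      using i z by (simp add: w_def)
  qed
  then show False
    using z by auto
qed

section \<open>Resolvent equations above the spectral radius\<close>

lemma resolvent_solution:
  assumes M: "M \<in> carrier_mat N N" and s: "rho M < s" and f: "f \<in> carrier_vec N"
  obtains y where "y \<in> carrier_vec N" "s \<cdot>\<^sub>v y = M *\<^sub>v y + f"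
proof -
  define L where "L = s \<cdot>\<^sub>m 1\<^sub>m N - M"
  have L: "L \<in> carrier_mat N N"
    unfolding L_def by (rule minus_carrier_mat[OF M])
  have Lv: "L *\<^sub>v v = s \<cdot>\<^sub>v v - M *\<^sub>v v" if "v \<in> carrier_vec N" for v
    using that M unfolding L_def
    by (subst minus_mult_distrib_mat_vec[of _ N N]) (auto intro!: eq_vecI)
  \<comment> \<open>A real kernel vector of \<open>L\<close>, read over the complex numbers, is an
    eigenvector of \<open>M\<close> for \<open>s\<close>; this would force
    \<open>s \<le> rho M\<close>.\<close>
  have "det L \<noteq> 0"
  proof
    assume "det L = 0"
    then obtain v where v: "v \<in> carrier_vec N" "v \<noteq> 0\<^sub>v N" "L *\<^sub>v v = 0\<^sub>v N"
      using det_0_iff_vec_prod_zero_field[OF L] by blast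
    have "M *\<^sub>v v = s \<cdot>\<^sub>v v"
    proof (rule eq_vecI)
      fix i assume i: "i < dim_vec (s \<cdot>\<^sub>v v)"
      have "(s \<cdot>\<^sub>v v - M *\<^sub>v v) $ i = 0"
        using v(3) Lv[OF v(1)] i v(1) by simp
      then show "(M *\<^sub>v v) $ i = (s \<cdot>\<^sub>v v) $ i"
        using i v M by simp
    qed (use v M in simp)
    then have "map_mat complex_of_real M *\<^sub>v map_vec complex_of_real v = of_real s \<cdot>\<^sub>v map_vec complex_of_real v"
      using of_real_hom.mult_mat_vec_hom[OF M v(1)] of_real_hom.vec_hom_smult by metis
    then have "norm (complex_of_real s) \<le> rho M"
      using v by (intro norm_le_rho[OF M, of "map_vec complex_of_real v"]) auto
    then show False
      using s by simp
  qed
  from det_non_zero_imp_unit[OF L this, of "()"]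
  obtain B where B: "B \<in> carrier_mat N N" "L * B = 1\<^sub>m N"
    unfolding Units_def ring_mat_def by auto
  have y: "B *\<^sub>v f \<in> carrier_vec N"
    using B f by simp
  have "L *\<^sub>v (B *\<^sub>v f) = f"
    using B f L by (simp flip: assoc_mult_mat_vec)
  then have eq: "s \<cdot>\<^sub>v (B *\<^sub>v f) - M *\<^sub>v (B *\<^sub>v f) = f"
    using Lv[OF y] by simp
  show ?thesis
  proof (rule that[OF y], rule eq_vecI)
    fix i assume "i < dim_vec (M *\<^sub>v (B *\<^sub>v f) + f)"
    then have i: "i < N"
      using f by simp
    have "(s \<cdot>\<^sub>v (B *\<^sub>v f) - M *\<^sub>v (B *\<^sub>v f)) $ i = f $ i"
      by (simp only: eq)
    then show "(s \<cdot>\<^sub>v (B *\<^sub>v f)) $ i = (M *\<^sub>v (B *\<^sub>v f) + f) $ i"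
      using i B f M by simp
  qed (use B f M in simp)
qed

text \<open>Normalizes a matrix into the range where its powers are uniformly bounded. An eigenvalue
  \<open>l\<close> of the scaled matrix corresponds to the eigenvalue \<open>s * l\<close> of
  \<open>M\<close>.\<close>

lemma rho_smult_less_one:
  assumes M: "M \<in> carrier_mat N N" and N: "N > 0" and s: "rho M < s"
  shows "rho (inverse s \<cdot>\<^sub>m M) < 1"
proof -
  have s0: "s > 0"
    using rho_nonneg[OF M N] s by simp
  have M': "inverse s \<cdot>\<^sub>m M \<in> carrier_mat N N"
    using M by simp
  obtain l z where z: "z \<in> carrier_vec N" "z \<noteq> 0\<^sub>v N" and l: "norm l = rho (inverse s \<cdot>\<^sub>m M)"
    and ev: "map_mat complex_of_real (inverse s \<cdot>\<^sub>m M) *\<^sub>v z = l \<cdot>\<^sub>v z"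
    using rho_eigenvector[OF M' N] .
  have "map_mat complex_of_real M *\<^sub>v z = (of_real s * l) \<cdot>\<^sub>v z"
  proof (rule eq_vecI)
    fix i assume "i < dim_vec ((of_real s * l) \<cdot>\<^sub>v z)"
    then have i: "i < N"
      using z by simp
    have "(map_mat complex_of_real (inverse s \<cdot>\<^sub>m M) *\<^sub>v z) $ i
        = of_real (inverse s) * (map_mat complex_of_real M *\<^sub>v z) $ i"
      using i z M by (simp add: scalar_prod_def sum_distrib_left mult.assoc)
    then have "l * z $ i = of_real (inverse s) * (map_mat complex_of_real M *\<^sub>v z) $ i"
      using ev i z by simp
    then show "(map_mat complex_of_real M *\<^sub>v z) $ i = ((of_real s * l) \<cdot>\<^sub>v z) $ i"
      using i z s0 by (simp add: field_simps)
  qed (use z M in simp)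
  from norm_le_rho[OF M z this] have "s * norm l \<le> rho M"
    using s0 by (simp add: norm_mult)
  then have "s * norm l < s * 1"
    using s by simp
  then show ?thesis
    using s0 l by simp
qed

text \<open>An intermediate \<open>s'\<close> with \<open>rho M < s' < s\<close> gives
  \<open>M = s' T\<close> with bounded powers of \<open>T\<close>, and a factor
  \<open>q = s' / s < 1\<close>. The equation yields \<open>q T y \<le> y\<close>, hence
  \<open>q^k T^k y \<le> y\<close> for all \<open>k\<close>, and the left side tends to 0.\<close>

lemma resolvent_nonneg:
  assumes M: "M \<in> carrier_mat N N" and N: "N > 0" and M0: "0\<^sub>m N N \<le> M" and s: "rho M < s"
    and f: "f \<in> carrier_vec N" "0\<^sub>v N \<le> f"
  obtains y where "y \<in> carrier_vec N" "0\<^sub>v N \<le> y" "s \<cdot>\<^sub>v y = M *\<^sub>v y + f"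
proof -
  obtain y where y: "y \<in> carrier_vec N" and eq: "s \<cdot>\<^sub>v y = M *\<^sub>v y + f"
    using resolvent_solution[OF M s f(1)] .
  obtain s' where s': "rho M < s'" "s' < s"
    using s dense by blast
  have pos: "s' > 0" "s > 0"
    using rho_nonneg[OF M N] s' by simp_all
  define T where "T = inverse s' \<cdot>\<^sub>m M"
  define q where "q = s' / s"
  have q: "0 \<le> q" "q < 1"
    using pos s' by (simp_all add: q_def)
  have T: "T \<in> carrier_mat N N" "0\<^sub>m N N \<le> T"
    using M M0 pos unfolding T_def less_eq_mat_def by auto
  have "map_mat complex_of_real T \<in> carrier_mat N N"
    using T by simp
  moreover have "spectral_radius (map_mat complex_of_real T) < 1"
    using rho_smult_less_one[OF M N s'(1)] unfolding T_def rho_def .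
  ultimately obtain c where c: "\<And>k. norm_bound (map_mat complex_of_real T ^\<^sub>m k) c"
    using spectral_radius_jnf_norm_bound_less_1_upper_triangular by blast
  have Tk: "T ^\<^sub>m k \<in> carrier_mat N N" for k
    using T by simp
  have bound: "\<bar>(T ^\<^sub>m k) $$ (i,j)\<bar> \<le> c" if "i < N" "j < N" for i j k
  proof -
    have "norm ((map_mat complex_of_real T ^\<^sub>m k) $$ (i,j)) \<le> c"
      using c[of k] that T unfolding norm_bound_def by simp
    then show ?thesis
      using that carrier_matD[OF Tk[of k]] unfolding of_real_hom.mat_hom_pow[OF T(1), symmetric] by simp
  qed
  \<comment> \<open>The nonnegative term \<open>f\<close> is dropped from
    \<open>s y = M y + f\<close>, and \<open>M\<close> is written as \<open>s' T\<close>.\<close>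
  have step: "q \<cdot>\<^sub>v (T *\<^sub>v y) \<le> y"
    unfolding less_eq_vec_def
  proof (intro conjI allI impI)
    fix i assume "i < dim_vec y"
    then have i: "i < N"
      using y by simp
    have "s * y $ i = (s \<cdot>\<^sub>v y) $ i"
      using i y by simp
    also have "\<dots> = (M *\<^sub>v y) $ i + f $ i"
      unfolding eq using i f M by simp
    also have "(M *\<^sub>v y) $ i = s' * (T *\<^sub>v y) $ i"
      using i y M pos by (simp add: T_def scalar_prod_def sum_distrib_left mult.assoc[symmetric])
    finally have "s' * (T *\<^sub>v y) $ i \<le> s * y $ i"
      using f i unfolding less_eq_vec_def by auto
    then show "(q \<cdot>\<^sub>v (T *\<^sub>v y)) $ i \<le> y $ i"
      using i T pos by (simp add: q_def field_simps)
  qed (use T y in simp)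
  have Tky: "T ^\<^sub>m k *\<^sub>v y \<in> carrier_vec N" for k
    using Tk[of k] y by simp
  have iter: "q ^ k \<cdot>\<^sub>v (T ^\<^sub>m k *\<^sub>v y) \<le> y" for k
  proof (induction k)
    case 0
    show ?case
      using y T unfolding less_eq_vec_def by auto
  next
    case (Suc k)
    have qk: "0\<^sub>m N N \<le> T ^\<^sub>m k"
    proof (induction k)
      case (Suc k)
      show ?case
        using mult_mat_nonneg[OF Tk[of k] T(1) Suc T(2)] by simp
    qed (use T in \<open>auto simp: less_eq_mat_def\<close>)
    have "T ^\<^sub>m k *\<^sub>v (q \<cdot>\<^sub>v (T *\<^sub>v y)) \<le> T ^\<^sub>m k *\<^sub>v y"
      by (rule mult_mat_vec_mono[OF Tk qk y step])
    also have "T ^\<^sub>m k *\<^sub>v (q \<cdot>\<^sub>v (T *\<^sub>v y)) = q \<cdot>\<^sub>v (T ^\<^sub>m Suc k *\<^sub>v y)"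
      using mult_mat_vec[OF Tk mult_mat_vec_carrier[OF T(1) y]] assoc_mult_mat_vec[OF Tk T(1) y] by simp
    finally have "q \<cdot>\<^sub>v (T ^\<^sub>m Suc k *\<^sub>v y) \<le> T ^\<^sub>m k *\<^sub>v y" .
    then have "q ^ Suc k * (T ^\<^sub>m Suc k *\<^sub>v y) $ i \<le> q ^ k * (T ^\<^sub>m k *\<^sub>v y) $ i" if "i < N" for i
      using that q carrier_matD[OF T(1)] Tky[of k] Tky[of "Suc k"] unfolding less_eq_vec_def
      by (auto intro!: mult_left_mono simp: mult.assoc mult.left_commute[of q] simp del: index_mult_mat_vec pow_mat.simps)
    then have "q ^ Suc k * (T ^\<^sub>m Suc k *\<^sub>v y) $ i \<le> y $ i" if "i < N" for i
      using Suc that y Tky[of k] unfolding less_eq_vec_def by fastforce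
    then show ?case
      using y carrier_vecD[OF Tky[of "Suc k"]] unfolding less_eq_vec_def by (auto simp del: dim_mult_mat_vec pow_mat.simps)
  qed
  have "0\<^sub>v N \<le> y"
    unfolding less_eq_vec_def
  proof (intro conjI allI impI)
    fix i assume "i < dim_vec y"
    then have i: "i < N"
      using y by simp
    \<comment> \<open>All entries of the powers of \<open>T\<close> are at most \<open>c\<close> in
      modulus, so \<open>c * Y\<close> bounds every entry of \<open>T^k y\<close> independently of
      \<open>k\<close>.\<close>
    define Y where "Y = (\<Sum>j = 0..<N. \<bar>y $ j\<bar>)"
    have "- (q ^ k * (c * Y)) \<le> y $ i" for k
    proof -
      have "\<bar>(T ^\<^sub>m k *\<^sub>v y) $ i\<bar> = \<bar>\<Sum>j = 0..<N. (T ^\<^sub>m k) $$ (i,j) * y $ j\<bar>"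
        using i y carrier_matD[OF Tk[of k]] by (simp add: scalar_prod_def del: pow_mat_dim_square)
      also have "\<dots> \<le> (\<Sum>j = 0..<N. \<bar>(T ^\<^sub>m k) $$ (i,j) * y $ j\<bar>)"
        by (rule sum_abs)
      also have "\<dots> \<le> (\<Sum>j = 0..<N. c * \<bar>y $ j\<bar>)"
        using bound i by (auto intro!: sum_mono mult_right_mono simp: abs_mult)
      finally have "\<bar>(T ^\<^sub>m k *\<^sub>v y) $ i\<bar> \<le> c * Y"
        by (simp add: Y_def sum_distrib_left)
      then have "q ^ k * - (c * Y) \<le> q ^ k * (T ^\<^sub>m k *\<^sub>v y) $ i"
        using q by (intro mult_left_mono) auto
      also have "\<dots> \<le> y $ i"
        using iter[of k] i y carrier_vecD[OF Tky[of k]] unfolding less_eq_vec_def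
        by (auto simp del: dim_mult_mat_vec)
      finally show ?thesis
        by simp
    qed
    moreover have "(\<lambda>k. - (q ^ k * (c * Y))) \<longlonglongrightarrow> - (0 * (c * Y))"
      using q by (intro tendsto_intros LIMSEQ_realpow_zero) auto
    ultimately have "- (0 * (c * Y)) \<le> y $ i"
      by (intro LIMSEQ_le_const2) auto
    then show "0\<^sub>v N $ i \<le> y $ i"
      using i by simp
  qed (use y in simp)
  then show ?thesis
    using that y eq by blast
qed

section \<open>Block companion matrices\<close>

text \<open>Linearization of the quadratic eigenvalue problem \<open>l^2 x = l C x + D x\<close>,
  whose eigenvectors have the form \<open>(l x, x)\<close>. All three block matrices of the theorem
  have this shape.\<close>

abbreviation companion :: "nat \<Rightarrow> real mat \<Rightarrow> real mat \<Rightarrow> real mat" where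
  "companion n C D \<equiv> four_block_mat C D (1\<^sub>m n) (0\<^sub>m n n)"

lemma companion_carrier:
  assumes "C \<in> carrier_mat n n"
  shows "companion n C D \<in> carrier_mat (n + n) (n + n)"
  using assms by (intro four_block_carrier_mat) auto

lemma companion_nonneg:
  assumes "C \<in> carrier_mat n n" "D \<in> carrier_mat n n" "0\<^sub>m n n \<le> C" "0\<^sub>m n n \<le> D"
  shows "0\<^sub>m (n + n) (n + n) \<le> companion n C D"
  using assms unfolding less_eq_mat_def by auto

lemma companion_mult_vec:
  assumes "C \<in> carrier_mat n n" "D \<in> carrier_mat n n" "p \<in> carrier_vec n" "q \<in> carrier_vec n"
  shows "companion n C D *\<^sub>v (p @\<^sub>v q) = (C *\<^sub>v p + D *\<^sub>v q) @\<^sub>v p"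
proof -
  have "1\<^sub>m n *\<^sub>v p + 0\<^sub>m n n *\<^sub>v q = p"
    using assms by (intro eq_vecI) auto
  then show ?thesis
    using assms by (subst four_block_mat_mult_vec[of _ n n _ n _ n]) auto
qed

text \<open>The test vector is \<open>(s x, x)\<close>, for which the lower block row is an
  equality. The identity block copies the upper component of a vector unchanged, so only after two
  applications do both components consist of images of \<open>C\<close> and \<open>D\<close>. This
  is why \<open>rho_le_if_subinvariant\<close> asks for domination of the squared matrix.\<close>

lemma rho_companion_le:
  assumes n: "n > 0" and C: "C \<in> carrier_mat n n" "0\<^sub>m n n \<le> C"
    and D: "D \<in> carrier_mat n n" "0\<^sub>m n n \<le> D"
    and x: "x \<in> carrier_vec n" "0\<^sub>v n \<le> x" and s: "0 < s"
    and sub: "\<And>i. i < n \<Longrightarrow> s * (C *\<^sub>v x) $ i + (D *\<^sub>v x) $ i \<le> s\<^sup>2 * x $ i"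
    and domC: "\<And>w. w \<in> carrier_vec n \<Longrightarrow> 0\<^sub>v n \<le> w \<Longrightarrow> \<exists>t. C *\<^sub>v w \<le> t \<cdot>\<^sub>v x"
    and domD: "\<And>w. w \<in> carrier_vec n \<Longrightarrow> 0\<^sub>v n \<le> w \<Longrightarrow> \<exists>t. D *\<^sub>v w \<le> t \<cdot>\<^sub>v x"
  shows "rho (companion n C D) \<le> s"
proof (rule rho_le_if_subinvariant[of _ "n + n" "s \<cdot>\<^sub>v x @\<^sub>v x"])
  let ?M = "companion n C D"
  show "?M *\<^sub>v (s \<cdot>\<^sub>v x @\<^sub>v x) \<le> s \<cdot>\<^sub>v (s \<cdot>\<^sub>v x @\<^sub>v x)"
    using sub x C D by (auto simp: companion_mult_vec less_eq_vec_def mult_mat_vec power2_eq_square mult.assoc)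
  show "\<exists>t. ?M *\<^sub>v (?M *\<^sub>v w) \<le> t \<cdot>\<^sub>v (s \<cdot>\<^sub>v x @\<^sub>v x)"
    if w: "w \<in> carrier_vec (n + n)" "0\<^sub>v (n + n) \<le> w" for w
  proof -
    define p where "p = vec_first w n"
    define q where "q = vec_last w n"
    have pq: "p \<in> carrier_vec n" "q \<in> carrier_vec n" and w_eq: "w = p @\<^sub>v q"
      using w by (auto simp: p_def q_def)
    have pq0: "0\<^sub>v n \<le> p" "0\<^sub>v n \<le> q"
      using w unfolding p_def q_def less_eq_vec_def by (auto simp: vec_first_def vec_last_def)
    define g where "g = C *\<^sub>v p + D *\<^sub>v q"
    have g: "g \<in> carrier_vec n" "0\<^sub>v n \<le> g"
      using mult_mat_vec_nonneg[OF C pq(1) pq0(1)] mult_mat_vec_nonneg[OF D pq(2) pq0(2)] C D pq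
      unfolding g_def less_eq_vec_def by auto
    have MMw: "?M *\<^sub>v (?M *\<^sub>v w) = (C *\<^sub>v g + D *\<^sub>v p) @\<^sub>v g"
      unfolding w_eq using C D pq g by (simp add: companion_mult_vec flip: g_def)
    obtain t1 where t1: "C *\<^sub>v g \<le> t1 \<cdot>\<^sub>v x"
      using domC[OF g] by blast
    obtain t2 where t2: "D *\<^sub>v p \<le> t2 \<cdot>\<^sub>v x"
      using domD[OF pq(1) pq0(1)] by blast
    obtain t3 where t3: "C *\<^sub>v p \<le> t3 \<cdot>\<^sub>v x"
      using domC[OF pq(1) pq0(1)] by blast
    obtain t4 where t4: "D *\<^sub>v q \<le> t4 \<cdot>\<^sub>v x"
      using domD[OF pq(2) pq0(2)] by blast
    \<comment> \<open>There is one constraint per block: the upper block of the test vector is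
      \<open>s x\<close>, hence the division by \<open>s\<close>, and the lower one is
      \<open>x\<close>.\<close>
    define t where "t = max ((t1 + t2) / s) (t3 + t4)"
    have t: "t1 + t2 \<le> t * s" "t3 + t4 \<le> t"
      using s by (auto simp: t_def field_simps max_def)
    have "(C *\<^sub>v g + D *\<^sub>v p) $ i \<le> t * s * x $ i" if i: "i < n" for i
    proof -
      have "(C *\<^sub>v g + D *\<^sub>v p) $ i \<le> (t1 + t2) * x $ i"
        using t1 t2 i C D x unfolding less_eq_vec_def by (auto simp: distrib_right intro: add_mono)
      also have "\<dots> \<le> t * s * x $ i"
        using t x i unfolding less_eq_vec_def by (intro mult_right_mono) auto
      finally show ?thesis .
    qed
    moreover have "g $ i \<le> t * x $ i" if i: "i < n" for i
    proof -
      have "g $ i \<le> (t3 + t4) * x $ i"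
        using t3 t4 i C D x unfolding less_eq_vec_def g_def by (auto simp: distrib_right intro: add_mono)
      also have "\<dots> \<le> t * x $ i"
        using t x i unfolding less_eq_vec_def by (intro mult_right_mono) auto
      finally show ?thesis .
    qed
    ultimately have "?M *\<^sub>v (?M *\<^sub>v w) \<le> t \<cdot>\<^sub>v (s \<cdot>\<^sub>v x @\<^sub>v x)"
      unfolding MMw using C D g x unfolding less_eq_vec_def by (auto simp: mult.assoc)
    then show ?thesis ..
  qed
  show "0\<^sub>v (n + n) \<le> s \<cdot>\<^sub>v x @\<^sub>v x"
    using x s unfolding less_eq_vec_def by auto
qed (use n s x C D in \<open>auto intro: companion_nonneg\<close>)

text \<open>The resolvent equation is solved with right-hand side \<open>(f, 0)\<close>. Its lower
  row makes the upper component \<open>s\<close> times the lower one, and substitution into the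
  upper row gives the quadratic equation for the lower component.\<close>

lemma companion_resolvent_nonneg:
  assumes n: "n > 0" and C: "C \<in> carrier_mat n n" "0\<^sub>m n n \<le> C"
    and D: "D \<in> carrier_mat n n" "0\<^sub>m n n \<le> D"
    and s: "rho (companion n C D) < s"
    and f: "f \<in> carrier_vec n" "0\<^sub>v n \<le> f"
  obtains x where "x \<in> carrier_vec n" "0\<^sub>v n \<le> x"
    "s\<^sup>2 \<cdot>\<^sub>v x = s \<cdot>\<^sub>v (C *\<^sub>v x) + D *\<^sub>v x + f"
proof -
  have "f @\<^sub>v 0\<^sub>v n \<in> carrier_vec (n + n)" "0\<^sub>v (n + n) \<le> f @\<^sub>v 0\<^sub>v n"
    using f unfolding less_eq_vec_def by auto
  from resolvent_nonneg[OF companion_carrier[OF C(1), of D] _ companion_nonneg[OF C(1) D(1) C(2) D(2)] s this] n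
  obtain y where y: "y \<in> carrier_vec (n + n)" "0\<^sub>v (n + n) \<le> y"
    and eq: "s \<cdot>\<^sub>v y = companion n C D *\<^sub>v y + (f @\<^sub>v 0\<^sub>v n)"
    by auto
  define p where "p = vec_first y n"
  define q where "q = vec_last y n"
  have pq: "p \<in> carrier_vec n" "q \<in> carrier_vec n" and y_eq: "y = p @\<^sub>v q"
    using y by (auto simp: p_def q_def)
  have q0: "0\<^sub>v n \<le> q"
    using y unfolding q_def less_eq_vec_def by (auto simp: vec_last_def)
  have "s \<cdot>\<^sub>v p @\<^sub>v s \<cdot>\<^sub>v q = s \<cdot>\<^sub>v (p @\<^sub>v q)"
    using pq by (intro eq_vecI) auto
  also have "\<dots> = ((C *\<^sub>v p + D *\<^sub>v q) @\<^sub>v p) + (f @\<^sub>v 0\<^sub>v n)"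
    using eq C D pq unfolding y_eq by (simp add: companion_mult_vec)
  also have "\<dots> = (C *\<^sub>v p + D *\<^sub>v q + f) @\<^sub>v p"
    using C D pq f by (subst append_vec_add[of _ n _ _ n]) auto
  finally have "s \<cdot>\<^sub>v p = C *\<^sub>v p + D *\<^sub>v q + f" and "s \<cdot>\<^sub>v q = p"
    using C D pq f append_vec_eq[of "s \<cdot>\<^sub>v p" n "C *\<^sub>v p + D *\<^sub>v q + f"] by auto
  then have "s\<^sup>2 \<cdot>\<^sub>v q = s \<cdot>\<^sub>v (C *\<^sub>v q) + D *\<^sub>v q + f"
    using C pq by (auto simp: mult_mat_vec power2_eq_square simp flip: smult_smult_assoc)
  then show ?thesis
    using that pq q0 by blast
qed

section \<open>Moore--Penrose inverses\<close>

lemma generalized_inverse_exists: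
  fixes A :: "'a :: field mat"
  assumes A: "A \<in> carrier_mat nr nc"
  obtains G where "G \<in> carrier_mat nc nr" "A * G * A = A"
proof -
  \<comment> \<open>The transpose of the pivot pattern is a generalized inverse of the reduced echelon form.\<close>
  define C where "C = gauss_jordan_single A"
  note gj = gauss_jordan_single[OF A C_def[symmetric]]
  have C: "C \<in> carrier_mat nr nc"
    by (rule gj(2))
  obtain f where f: "pivot_fun C f nc"
    using gj(3) C unfolding row_echelon_form_def by auto
  note piv = pivot_funD[OF _ f, of nr]
  obtain P Q where PQ: "C = P * A" "P \<in> carrier_mat nr nr" "Q \<in> carrier_mat nr nr" "Q * P = 1\<^sub>m nr"
    using gj(4) by blast
  define H where "H = mat nc nr (\<lambda>(j,i). if f i = j then 1 else (0 :: 'a))"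
  have H: "H \<in> carrier_mat nc nr"
    by (simp add: H_def)
  \<comment> \<open>Pivot columns of \<open>C\<close> are unit vectors, so \<open>C * H\<close> is
    the diagonal projector onto the pivot rows. A zero row has \<open>f i = nc\<close>, for which
    column \<open>i\<close> of \<open>H\<close> is zero.\<close>
  have CH: "(C * H) $$ (k,i) = (if k = i \<and> f i < nc then 1 else 0)" if "k < nr" "i < nr" for k i
  proof -
    have "(C * H) $$ (k,i) = (\<Sum>j = 0..<nc. if f i = j then C $$ (k,j) else 0)"
      using that C unfolding H_def by (simp add: scalar_prod_def if_distrib[of "times _"] cong: if_cong)
    also have "\<dots> = (if f i < nc then C $$ (k, f i) else 0)"
      by simp
    finally show ?thesis
      using piv(4,5) that C by auto
  qed
  have CHC: "C * H * C = C"
  proof (rule eq_matI)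
    fix k j assume "k < dim_row C" "j < dim_col C"
    then have kj: "k < nr" "j < nc"
      using C by auto
    have "(C * H * C) $$ (k,j) = (\<Sum>i = 0..<nr. (C * H) $$ (k,i) * C $$ (i,j))"
      using index_mult_mat(1)[of k "C * H" j C] kj C H
      by (auto simp: scalar_prod_def simp del: assoc_mult_mat intro!: sum.cong)
    also have "\<dots> = (\<Sum>i = 0..<nr. if k = i then (if f k < nc then C $$ (k,j) else 0) else 0)"
      using kj by (intro sum.cong) (auto simp: CH)
    also have "\<dots> = (if f k < nc then C $$ (k,j) else 0)"
      using kj by simp
    also have "\<dots> = C $$ (k,j)"
      using piv(1,2) kj C by (metis carrier_matD(1) le_neq_implies_less)
    finally show "(C * H * C) $$ (k,j) = C $$ (k,j)" .
  qed (use C H in auto)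
  have A_eq: "A = Q * C"
    using PQ A by (simp flip: assoc_mult_mat)
  have HP: "H * P \<in> carrier_mat nc nr" and HC: "H * C \<in> carrier_mat nc nc"
    using H PQ(2) C by auto
  \<comment> \<open>The row operations are undone: with \<open>C = P A\<close> and
    \<open>A = Q C\<close>, the inverse \<open>H\<close> of the echelon form pulls back to
    \<open>H * P\<close>.\<close>
  have "A * (H * P) * A = A * (H * C)"
    unfolding assoc_mult_mat[OF A HP A] assoc_mult_mat[OF H PQ(2) A] PQ(1)[symmetric] ..
  also have "\<dots> = Q * (C * (H * C))"
    using assoc_mult_mat[OF PQ(3) C HC] A_eq by simp
  also have "\<dots> = A"
    using CHC A_eq assoc_mult_mat[OF C H C] by simp
  finally show ?thesis
    using that[of "H * P"] H PQ by simp
qed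

text \<open>The diagonal entries of the product are the squared Euclidean norms of the columns of
  \<open>M\<close>.\<close>

lemma transpose_mult_self_zero_imp_zero:
  fixes M :: "real mat"
  assumes "transpose_mat M * M = 0\<^sub>m (dim_col M) (dim_col M)"
  shows "M = 0\<^sub>m (dim_row M) (dim_col M)"
proof (rule eq_matI)
  fix i j assume "i < dim_row (0\<^sub>m (dim_row M) (dim_col M) :: real mat)" "j < dim_col (0\<^sub>m (dim_row M) (dim_col M) :: real mat)"
  then have ij: "i < dim_row M" "j < dim_col M"
    by auto
  have "(\<Sum>i = 0..<dim_row M. M $$ (i,j) * M $$ (i,j)) = (transpose_mat M * M) $$ (j,j)"
    using ij by (simp add: scalar_prod_def)
  also have "\<dots> = 0"
    unfolding assms using ij by simp
  finally have "M $$ (i,j) * M $$ (i,j) = 0"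
    using ij by (subst (asm) sum_nonneg_eq_0_iff) auto
  then show "M $$ (i,j) = 0\<^sub>m (dim_row M) (dim_col M) $$ (i,j)"
    using ij by simp
qed auto

text \<open>Normal equations: \<open>X = G A^T\<close> with \<open>G\<close> a generalized inverse
  of \<open>A^T A\<close>. The defect \<open>N = A X A - A\<close> satisfies
  \<open>A^T N = 0\<close>, while its columns lie in the range of \<open>A\<close>; hence
  \<open>N^T N = 0\<close> and \<open>N\<close> vanishes.\<close>

lemma least_squares_inverse_exists:
  fixes A :: "real mat"
  assumes A: "A \<in> carrier_mat m n"
  obtains X where "X \<in> carrier_mat n m" "A * X * A = A" "transpose_mat (A * X) = A * X"
proof -
  let ?B = "transpose_mat A * A"
  have B: "?B \<in> carrier_mat n n"
    using A by simp
  obtain G where G: "G \<in> carrier_mat n n" "?B * G * ?B = ?B"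
    using generalized_inverse_exists[OF B] .
  define X where "X = G * transpose_mat A"
  have X: "X \<in> carrier_mat n m"
    using G A by (simp add: X_def)
  define N where "N = A * X * A - A"
  have N: "N \<in> carrier_mat m n"
    unfolding N_def by (rule minus_carrier_mat[OF A])
  have AT: "A\<^sup>T \<in> carrier_mat n m"
    using A by simp
  have GB: "G * ?B \<in> carrier_mat n n"
    using G B by simp
  have "A * X * A = A * (X * A)"
    by (rule assoc_mult_mat[OF A X A])
  also have "X * A = G * ?B"
    unfolding X_def by (rule assoc_mult_mat[OF G(1) AT A])
  finally have "A\<^sup>T * (A * X * A) = ?B * G * ?B"
    using assoc_mult_mat[OF AT A GB] assoc_mult_mat[OF B G(1) B] by simp
  then have "A\<^sup>T * N = ?B * G * ?B - ?B"
    unfolding N_def using A X AT by (subst mult_minus_distrib_mat[of _ n m _ n]) auto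
  also have "\<dots> = 0\<^sub>m n n"
    unfolding G(2) using B by (intro minus_r_inv_mat)
  finally have ATN: "A\<^sup>T * N = 0\<^sub>m n n" .
  have "N = A * (X * A - 1\<^sub>m n)"
    unfolding N_def using A X by (simp add: mult_minus_distrib_mat[of _ m n _ n])
  then have "N\<^sup>T = (X * A - 1\<^sub>m n)\<^sup>T * A\<^sup>T"
    using transpose_mult[OF A, of "X * A - 1\<^sub>m n" n] by (simp add: minus_carrier_mat)
  then have "N\<^sup>T * N = (X * A - 1\<^sub>m n)\<^sup>T * (A\<^sup>T * N)"
    using assoc_mult_mat[OF _ AT N, of "(X * A - 1\<^sub>m n)\<^sup>T" n] by (simp add: minus_carrier_mat)
  also have "\<dots> = 0\<^sub>m n n"
    unfolding ATN by (intro right_mult_zero_mat[of _ n n]) (simp add: minus_carrier_mat)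
  finally have "N = 0\<^sub>m m n"
    using transpose_mult_self_zero_imp_zero[of N] N by simp
  then have EA: "A * X * A = A"
    unfolding N_def using A X by (intro eq_matI) (auto simp: mat_eq_iff)
  \<comment> \<open>As \<open>G\<close> may fail to be symmetric, symmetry of \<open>A * X\<close>
    is obtained from \<open>E E^T = E\<close>, whose left side is symmetric.\<close>
  let ?E = "A * X"
  have E: "?E \<in> carrier_mat m m"
    using A X by simp
  have "A\<^sup>T * ?E\<^sup>T = A\<^sup>T"
    using transpose_mult[OF E A] EA by simp
  moreover have "?E = A * G * A\<^sup>T"
    unfolding X_def by (rule assoc_mult_mat[OF A G(1) AT, symmetric])
  ultimately have "?E * ?E\<^sup>T = ?E"
    using assoc_mult_mat[OF mult_carrier_mat[OF A G(1)] AT, of "?E\<^sup>T" m] E by simp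
  then have "?E\<^sup>T = ?E"
    using transpose_mult[OF E, of "?E\<^sup>T" m] E by simp
  then show ?thesis
    using that X EA by blast
qed

text \<open>The Penrose conditions under the description operator of \<open>mp_inv\<close>, isolated
  so that existence and uniqueness can be stated for them.\<close>

definition moore_penrose :: "real mat \<Rightarrow> real mat \<Rightarrow> bool" where
  "moore_penrose A X \<longleftrightarrow> X \<in> carrier_mat (dim_col A) (dim_row A) \<and>
      A * X * A = A \<and> X * A * X = X \<and>
      transpose_mat (A * X) = A * X \<and> transpose_mat (X * A) = X * A"

text \<open>Two one-sided inverses are combined: \<open>X\<close> makes \<open>A X\<close>
  symmetric, and \<open>Z\<close>, obtained from the transpose of \<open>A\<close>, makes
  \<open>Z A\<close> symmetric. The product \<open>Z A X\<close> inherits both, because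
  \<open>A (Z A X) = A X\<close> and \<open>(Z A X) A = Z A\<close>.\<close>

lemma moore_penrose_exists: "\<exists>X. moore_penrose A X"
proof -
  define m n where "m = dim_row A" and "n = dim_col A"
  have A: "A \<in> carrier_mat m n" "A\<^sup>T \<in> carrier_mat n m"
    by (auto simp: m_def n_def)
  obtain X where X: "X \<in> carrier_mat n m" "A * X * A = A" "(A * X)\<^sup>T = A * X"
    using least_squares_inverse_exists[OF A(1)] .
  obtain Y where Y: "Y \<in> carrier_mat m n" "A\<^sup>T * Y * A\<^sup>T = A\<^sup>T" "(A\<^sup>T * Y)\<^sup>T = A\<^sup>T * Y"
    using least_squares_inverse_exists[OF A(2)] .
  define Z where "Z = Y\<^sup>T"
  have Z: "Z \<in> carrier_mat n m"
    using Y by (simp add: Z_def)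
  have ZA: "(A\<^sup>T * Y)\<^sup>T = Z * A"
    using transpose_mult[OF A(2) Y(1)] by (simp add: Z_def)
  have ZA_sym: "(Z * A)\<^sup>T = Z * A"
    using Y(3) ZA by simp
  have "(A\<^sup>T * Y * A\<^sup>T)\<^sup>T = A * (Z * A)"
    using transpose_mult[of "A\<^sup>T * Y" n n "A\<^sup>T" m] A Y(1) ZA by simp
  then have AZA: "A * (Z * A) = A"
    unfolding Y(2) by simp
  have AXA: "A * (X * A) = A"
    using X A by simp
  have 1: "A * (Z * A * X) = A * X"
    using AZA assoc_mult_mat[of A m n "Z * A" n X m] A X(1) Z by simp
  have 2: "Z * A * X * A = Z * A"
    using AXA A X(1) Z assoc_mult_mat[of "Z * A" n n X m A n] assoc_mult_mat[of Z n m A n "X * A" n] by simp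
  have "Z * A * X * A * (Z * A * X) = Z * A * (Z * A * X)"
    unfolding 2 ..
  also have "\<dots> = Z * A * X"
    using 1 assoc_mult_mat[OF Z A(1) mult_carrier_mat[OF mult_carrier_mat[OF Z A(1)] X(1)]]
      assoc_mult_mat[OF Z A(1) X(1)] by argo
  finally have "moore_penrose A (Z * A * X)"
    unfolding moore_penrose_def 1 2 using A X Z ZA_sym by simp
  then show ?thesis ..
qed

text \<open>Transposing \<open>A X = (A Y) (A X)\<close> gives
  \<open>A X = (A X) (A Y) = A Y\<close>, and symmetrically \<open>X A = Y A\<close>. Then
  \<open>X = X A X\<close> can be rewritten one side at a time into
  \<open>Y A Y = Y\<close>.\<close>

lemma moore_penrose_unique:
  assumes X: "moore_penrose A X" and Y: "moore_penrose A Y"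
  shows "X = Y"
proof -
  define m n where "m = dim_row A" and "n = dim_col A"
  have A: "A \<in> carrier_mat m n"
    by (auto simp: m_def n_def)
  note X' = X[unfolded moore_penrose_def, folded m_def n_def]
  note Y' = Y[unfolded moore_penrose_def, folded m_def n_def]
  have c: "A * X \<in> carrier_mat m m" "A * Y \<in> carrier_mat m m"
    "X * A \<in> carrier_mat n n" "Y * A \<in> carrier_mat n n"
    using A X' Y' by auto
  have "A * Y * (A * X) = A * Y * A * X"
    using A X' Y' by (intro assoc_mult_mat[symmetric]) auto
  then have "(A * X)\<^sup>T = (A * Y * (A * X))\<^sup>T"
    using Y' by simp
  also have "\<dots> = (A * X)\<^sup>T * (A * Y)\<^sup>T"
    by (rule transpose_mult[OF c(2,1)])
  also have "\<dots> = A * X * A * Y"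
    using assoc_mult_mat[OF c(1) A, of Y m] X' Y' by simp
  finally have AX: "A * X = A * Y"
    using X' by simp
  have "X * A * (Y * A) = X * (A * Y * A)"
    using assoc_mult_mat[of X n m A n "Y * A" n] assoc_mult_mat[of A m n Y m A n] A X' Y' c by simp
  then have "(X * A)\<^sup>T = (X * A * (Y * A))\<^sup>T"
    using Y' by simp
  also have "\<dots> = (Y * A)\<^sup>T * (X * A)\<^sup>T"
    by (rule transpose_mult[OF c(3,4)])
  also have "\<dots> = Y * (A * X * A)"
    using assoc_mult_mat[of Y n m A n "X * A" n] assoc_mult_mat[of A m n X m A n] A X' Y' c by simp
  finally have XA: "X * A = Y * A"
    using X' by simp
  have "X = X * A * X"
    using X' by simp
  also have "\<dots> = Y * (A * X)"
    unfolding XA using A X' Y' by (intro assoc_mult_mat) auto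
  also have "\<dots> = Y"
    unfolding AX using assoc_mult_mat[of Y n m A n Y m] A Y' by simp
  finally show ?thesis .
qed

lemma moore_penrose_mp_inv: "moore_penrose A (mp_inv A)"
proof -
  have "\<exists>!X. moore_penrose A X"
    using moore_penrose_exists moore_penrose_unique by blast
  then have "moore_penrose A (THE X. moore_penrose A X)"
    by (rule theI')
  then show ?thesis
    by (simp add: mp_inv_def moore_penrose_def)
qed

lemma mp_inv:
  assumes "A \<in> carrier_mat m n"
  shows "mp_inv A \<in> carrier_mat n m" "A * mp_inv A * A = A" "mp_inv A * A * mp_inv A = mp_inv A"
    "(A * mp_inv A)\<^sup>T = A * mp_inv A" "(mp_inv A * A)\<^sup>T = mp_inv A * A"
  using moore_penrose_mp_inv[of A] assms unfolding moore_penrose_def by auto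

section \<open>Orthogonal projectors onto range and row space\<close>

lemma eq_mat_if_mult_vec_eq:
  fixes A B :: "'a :: semiring_1 mat"
  assumes A: "A \<in> carrier_mat m n" and B: "B \<in> carrier_mat m n"
    and eq: "\<And>v. v \<in> carrier_vec n \<Longrightarrow> A *\<^sub>v v = B *\<^sub>v v"
  shows "A = B"
proof (rule eq_matI)
  fix i j assume "i < dim_row B" "j < dim_col B"
  then have ij: "i < m" "j < n"
    using B by auto
  have "(A *\<^sub>v unit_vec n j) $ i = (B *\<^sub>v unit_vec n j) $ i"
    using eq[of "unit_vec n j"] by simp
  then show "A $$ (i,j) = B $$ (i,j)"
    using ij A B by (simp add: scalar_prod_right_unit)
qed (use A B in auto)

text \<open>\<open>A * mp_inv A\<close> acts as the identity on the range of \<open>A\<close>, where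
  all images under \<open>B\<close> lie.\<close>

lemma mult_mp_inv_absorb_left:
  assumes A: "A \<in> carrier_mat m n" and B: "B \<in> carrier_mat m k"
    and range: "range_mat B \<subseteq> range_mat A"
  shows "A * mp_inv A * B = B"
proof (rule eq_mat_if_mult_vec_eq)
  note Ad = mp_inv(1,2)[OF A]
  have P: "A * mp_inv A \<in> carrier_mat m m"
    using A Ad(1) by simp
  fix v :: "real vec" assume v: "v \<in> carrier_vec k"
  have "B *\<^sub>v v \<in> range_mat B"
    using B v unfolding range_mat_def by auto
  then obtain x where x: "x \<in> carrier_vec n" "B *\<^sub>v v = A *\<^sub>v x"
    using range A unfolding range_mat_def by auto
  have "A * mp_inv A * B *\<^sub>v v = A * mp_inv A *\<^sub>v (A *\<^sub>v x)"
    using assoc_mult_mat_vec[OF P B v] x(2) by simp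
  also have "\<dots> = A * mp_inv A * A *\<^sub>v x"
    by (rule assoc_mult_mat_vec[OF P A x(1), symmetric])
  finally show "A * mp_inv A * B *\<^sub>v v = B *\<^sub>v v"
    unfolding Ad(2) x(2) .
qed (use A B mp_inv(1)[OF A] in auto)

text \<open>A vector and its image under \<open>mp_inv A * A\<close> differ by an element of the
  null space of \<open>A\<close>, which \<open>B\<close> annihilates.\<close>

lemma mult_mp_inv_absorb_right:
  assumes A: "A \<in> carrier_mat m n" and B: "B \<in> carrier_mat k n"
    and null: "null_mat A \<subseteq> null_mat B"
  shows "B * (mp_inv A * A) = B"
proof (rule eq_mat_if_mult_vec_eq)
  note Ad = mp_inv(1,2)[OF A]
  have P: "mp_inv A * A \<in> carrier_mat n n"
    using A Ad by simp
  fix v :: "real vec" assume v: "v \<in> carrier_vec n"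
  define w where "w = mp_inv A * A *\<^sub>v v"
  have w: "w \<in> carrier_vec n"
    unfolding w_def by (rule mult_mat_vec_carrier[OF P v])
  have "A *\<^sub>v w = A *\<^sub>v v"
    using assoc_mult_mat_vec[OF A P v] assoc_mult_mat[OF A Ad(1) A] Ad(2) by (simp add: w_def)
  then have "v - w \<in> null_mat A"
    using A v w unfolding null_mat_def by (simp add: mult_minus_distrib_mat_vec[of _ m n])
  then have "B *\<^sub>v v - B *\<^sub>v w = 0\<^sub>v k"
    using null B v w unfolding null_mat_def by (auto simp: mult_minus_distrib_mat_vec[of _ k n])
  then have "B *\<^sub>v w = B *\<^sub>v v"
    using B by (auto simp: vec_eq_iff)
  then show "B * (mp_inv A * A) *\<^sub>v v = B *\<^sub>v v"
    using assoc_mult_mat_vec[OF B P v] by (simp add: w_def)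
qed (use A B mp_inv(1)[OF A] in auto)

text \<open>Two projectors with the same range fix each other under left multiplication; since both
  are symmetric, transposing one of these identities makes them equal.\<close>

lemma range_projection_cong:
  assumes A: "A \<in> carrier_mat m n" and B: "B \<in> carrier_mat m k" and eq: "range_mat A = range_mat B"
  shows "A * mp_inv A = B * mp_inv B"
proof -
  note Ad = mp_inv[OF A] and Bd = mp_inv[OF B]
  have c: "A * mp_inv A \<in> carrier_mat m m" "B * mp_inv B \<in> carrier_mat m m"
    using A B Ad Bd by auto
  have 1: "A * mp_inv A * (B * mp_inv B) = B * mp_inv B"
    using mult_mp_inv_absorb_left[OF A B] eq Bd(1) B c by (simp flip: assoc_mult_mat[OF c(1) B Bd(1)])
  have 2: "B * mp_inv B * (A * mp_inv A) = A * mp_inv A"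
    using mult_mp_inv_absorb_left[OF B A] eq Ad(1) A c by (simp flip: assoc_mult_mat[OF c(2) A Ad(1)])
  have "B * mp_inv B = (A * mp_inv A * (B * mp_inv B))\<^sup>T"
    using 1 Bd by simp
  also have "\<dots> = B * mp_inv B * (A * mp_inv A)"
    using transpose_mult[OF c] Ad Bd by simp
  finally show ?thesis
    using 2 by simp
qed

lemma null_projection_cong:
  assumes A: "A \<in> carrier_mat m n" and B: "B \<in> carrier_mat k n" and eq: "null_mat A = null_mat B"
  shows "mp_inv A * A = mp_inv B * B"
proof -
  note Ad = mp_inv[OF A] and Bd = mp_inv[OF B]
  have c: "mp_inv A * A \<in> carrier_mat n n" "mp_inv B * B \<in> carrier_mat n n"
    using A B Ad Bd by auto
  have 1: "mp_inv B * B * (mp_inv A * A) = mp_inv B * B"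
    using mult_mp_inv_absorb_right[OF A B] eq assoc_mult_mat[OF Bd(1) B c(1)] by simp
  have 2: "mp_inv A * A * (mp_inv B * B) = mp_inv A * A"
    using mult_mp_inv_absorb_right[OF B A] eq assoc_mult_mat[OF Ad(1) A c(2)] by simp
  have "mp_inv B * B = (mp_inv B * B * (mp_inv A * A))\<^sup>T"
    using 1 Bd by simp
  also have "\<dots> = mp_inv A * A * (mp_inv B * B)"
    using transpose_mult[OF c(2,1)] Ad Bd by simp
  finally show ?thesis
    using 2 by simp
qed

section \<open>Double proper splittings\<close>

lemma mat_le_iff: "mat_le B C \<longleftrightarrow> B \<le> C"
  by (auto simp: mat_le_def less_eq_mat_def)

text \<open>Supplies the domination hypotheses of \<open>rho_companion_le\<close>: up to the factor
  \<open>K\<close>, every image under a nonnegative \<open>Q\<close> lies below the image of the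
  all-ones vector.\<close>

lemma mult_vec_dominated:
  fixes Q :: "real mat"
  assumes Q: "Q \<in> carrier_mat n m" "0\<^sub>m n m \<le> Q" and z: "z \<in> carrier_vec m"
    and x: "x \<in> carrier_vec n" "Q *\<^sub>v vec m (\<lambda>_. 1) \<le> c \<cdot>\<^sub>v x"
  shows "\<exists>t. Q *\<^sub>v z \<le> t \<cdot>\<^sub>v x"
proof -
  define K where "K = (\<Sum>i = 0..<m. \<bar>z $ i\<bar>)"
  have K: "K \<ge> 0"
    by (simp add: K_def)
  have "z $ i \<le> K" if "i < m" for i
  proof -
    have "\<bar>z $ i\<bar> \<le> K"
      unfolding K_def using that by (intro member_le_sum) auto
    then show ?thesis
      by simp
  qed
  then have "z \<le> K \<cdot>\<^sub>v vec m (\<lambda>_. 1)"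
    using z unfolding less_eq_vec_def by auto
  then have "Q *\<^sub>v z \<le> Q *\<^sub>v (K \<cdot>\<^sub>v vec m (\<lambda>_. 1))"
    by (intro mult_mat_vec_mono[OF Q]) auto
  also have "\<dots> = K \<cdot>\<^sub>v (Q *\<^sub>v vec m (\<lambda>_. 1))"
    by (rule mult_mat_vec[OF Q(1)]) simp
  also have "\<dots> \<le> (K * c) \<cdot>\<^sub>v x"
    using x Q K unfolding less_eq_vec_def
    by (auto simp: mult.assoc intro!: mult_left_mono simp del: index_mult_mat_vec)
  finally show ?thesis ..
qed

text \<open>For any \<open>s\<close> above the larger radius, the resolvent solution
  \<open>x\<close> for the larger pair with all-ones right-hand side is subinvariant for the smaller
  pair. It satisfies \<open>s^2 x \<ge> 1\<close> entrywise, so it dominates every vector; then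
  \<open>s\<close> decreases to the radius.\<close>

lemma rho_companion_mono:
  assumes n: "n > 0"
    and C: "C \<in> carrier_mat n n" "C' \<in> carrier_mat n n" "0\<^sub>m n n \<le> C" "C \<le> C'"
    and D: "D \<in> carrier_mat n n" "D' \<in> carrier_mat n n" "0\<^sub>m n n \<le> D" "D \<le> D'"
  shows "rho (companion n C D) \<le> rho (companion n C' D')"
proof (rule dense_ge)
  fix s assume s: "rho (companion n C' D') < s"
  have "0 < s"
    using rho_nonneg[OF companion_carrier[OF C(2), of D']] n s by simp
  define u where "u = vec n (\<lambda>_. 1 :: real)"
  have u: "u \<in> carrier_vec n" "0\<^sub>v n \<le> u"
    by (auto simp: u_def less_eq_vec_def)
  have "0\<^sub>m n n \<le> C'" "0\<^sub>m n n \<le> D'"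
    using C D order_trans by blast+
  then obtain x where x: "x \<in> carrier_vec n" "0\<^sub>v n \<le> x"
    and eq: "s\<^sup>2 \<cdot>\<^sub>v x = s \<cdot>\<^sub>v (C' *\<^sub>v x) + D' *\<^sub>v x + u"
    using companion_resolvent_nonneg[OF n C(2) _ D(2) _ s u] by blast
  have eq': "s\<^sup>2 * x $ i = s * (C' *\<^sub>v x) $ i + (D' *\<^sub>v x) $ i + 1" if "i < n" for i
    using arg_cong[OF eq, of "\<lambda>v. v $ i"] that x C D by (simp add: u_def)
  have mono: "(C *\<^sub>v x) $ i \<le> (C' *\<^sub>v x) $ i" "(D *\<^sub>v x) $ i \<le> (D' *\<^sub>v x) $ i"
    and nonneg: "0 \<le> (C *\<^sub>v x) $ i" "0 \<le> (D *\<^sub>v x) $ i" if "i < n" for i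
    using mult_mat_vec_mono_left[OF C(2,4) x] mult_mat_vec_mono_left[OF D(2,4) x]
      mult_mat_vec_nonneg[OF C(1,3) x] mult_mat_vec_nonneg[OF D(1,3) x] that C D
    unfolding less_eq_vec_def by (auto simp del: index_mult_mat_vec)
  have bound: "s * (C *\<^sub>v x) $ i + (D *\<^sub>v x) $ i + 1 \<le> s\<^sup>2 * x $ i" if "i < n" for i
    unfolding eq'[OF that] using mono[OF that] \<open>0 < s\<close> by (intro add_mono mult_left_mono) auto
  have dom: "\<exists>t. z \<le> t \<cdot>\<^sub>v x" if z: "z \<in> carrier_vec n" for z
  proof -
    have "1 \<le> s\<^sup>2 * x $ i" if "i < n" for i
      using bound[OF that] nonneg[OF that] \<open>0 < s\<close> mult_nonneg_nonneg[of s "(C *\<^sub>v x) $ i"] by linarith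
    then have "1\<^sub>m n *\<^sub>v vec n (\<lambda>_. 1) \<le> s\<^sup>2 \<cdot>\<^sub>v x"
      using x unfolding less_eq_vec_def by auto
    from mult_vec_dominated[OF _ _ z x(1) this] z show ?thesis
      by (auto simp: less_eq_mat_def)
  qed
  show "rho (companion n C D) \<le> s"
  proof (rule rho_companion_le[OF n C(1,3) D(1,3) x \<open>0 < s\<close>])
    show "s * (C *\<^sub>v x) $ i + (D *\<^sub>v x) $ i \<le> s\<^sup>2 * x $ i" if "i < n" for i
      using bound[OF that] by simp
  qed (use C D dom mult_mat_vec_carrier in blast)+
qed

text \<open>Equal ranges and null spaces mean equal orthogonal projectors, so all proper splittings
  of \<open>A\<close> share the projectors of \<open>A\<close>. This links the two splittings later
  on.\<close>

lemma double_proper_splittingD: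
  assumes "A \<in> carrier_mat m n" "double_proper_splitting A P R S"
  shows "P \<in> carrier_mat m n" "R \<in> carrier_mat m n" "S \<in> carrier_mat m n" "mp_inv P \<in> carrier_mat n m"
    "mp_inv P * P = mp_inv A * A" "P * mp_inv P = A * mp_inv A"
    "\<And>x. x \<in> carrier_vec n \<Longrightarrow> A *\<^sub>v x = P *\<^sub>v x - R *\<^sub>v x + S *\<^sub>v x"
proof -
  show c: "P \<in> carrier_mat m n" "R \<in> carrier_mat m n" "S \<in> carrier_mat m n"
    using assms unfolding double_proper_splitting_def by auto
  have eq: "range_mat P = range_mat A" "null_mat P = null_mat A" "A = P - R + S"
    using assms unfolding double_proper_splitting_def by auto
  show "mp_inv P \<in> carrier_mat n m"
    by (rule mp_inv(1)[OF c(1)])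
  show "mp_inv P * P = mp_inv A * A"
    by (rule null_projection_cong[OF c(1) assms(1) eq(2)])
  show "P * mp_inv P = A * mp_inv A"
    by (rule range_projection_cong[OF c(1) assms(1) eq(1)])
  show "A *\<^sub>v x = P *\<^sub>v x - R *\<^sub>v x + S *\<^sub>v x" if "x \<in> carrier_vec n" for x
    unfolding eq(3) using c that
    by (simp add: add_mult_distrib_mat_vec[of _ m n] minus_mult_distrib_mat_vec[of _ m n] minus_carrier_mat)
qed

lemma mult_splitting_vec:
  assumes A: "A \<in> carrier_mat m n" and spl: "double_proper_splitting A P R S"
    and X: "X \<in> carrier_mat n m" and x: "x \<in> carrier_vec n"
  shows "X *\<^sub>v (A *\<^sub>v x) = X *\<^sub>v (P *\<^sub>v x) - X *\<^sub>v (R *\<^sub>v x) + X *\<^sub>v (S *\<^sub>v x)"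
proof -
  note c = double_proper_splittingD(1-3)[OF A spl]
  have v: "P *\<^sub>v x \<in> carrier_vec m" "R *\<^sub>v x \<in> carrier_vec m" "S *\<^sub>v x \<in> carrier_vec m"
    using c x mult_mat_vec_carrier by blast+
  show ?thesis
    unfolding double_proper_splittingD(7)[OF A spl x]
    using v by (simp add: mult_add_distrib_mat_vec[OF X] mult_minus_distrib_mat_vec[OF X])
qed

lemma double_proper_regularD:
  assumes A: "A \<in> carrier_mat m n" and reg: "double_proper_regular A P R S"
  shows "double_proper_splitting A P R S" "0\<^sub>m n m \<le> mp_inv P" "0\<^sub>m m n \<le> R" "0\<^sub>m m n \<le> - S"
    "0\<^sub>m n n \<le> mp_inv P * R" "0\<^sub>m n n \<le> - (mp_inv P * S)"
proof -
  show spl: "double_proper_splitting A P R S" and P: "0\<^sub>m n m \<le> mp_inv P" and R: "0\<^sub>m m n \<le> R"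
    using reg A unfolding double_proper_regular_def mat_le_iff by auto
  note c = double_proper_splittingD(1-4)[OF A spl]
  have "S \<le> 0\<^sub>m m n"
    using reg A unfolding double_proper_regular_def mat_le_iff by auto
  then show S: "0\<^sub>m m n \<le> - S"
    unfolding less_eq_mat_def by auto
  show "0\<^sub>m n n \<le> mp_inv P * R"
    by (rule mult_mat_nonneg[OF c(4) c(2) P R])
  show "0\<^sub>m n n \<le> - (mp_inv P * S)"
    using mult_mat_nonneg[OF c(4) _ P S] c by simp
qed

lemma rho_double_proper_regular_less_one:
  assumes n: "n > 0" and A: "A \<in> carrier_mat m n" and A0: "0\<^sub>m n m \<le> mp_inv A"
    and reg: "double_proper_regular A P R S"
  shows "rho (companion n (mp_inv P * R) (- (mp_inv P * S))) < 1"
proof -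
  note regD = double_proper_regularD[OF A reg]
  note spl = double_proper_splittingD[OF A regD(1)]
  define Q where "Q = mp_inv P"
  have Q: "Q \<in> carrier_mat n m" "0\<^sub>m n m \<le> Q"
    using spl(4) regD(2) by (simp_all add: Q_def)
  define v where "v = vec m (\<lambda>_. 1 :: real)"
  have v: "v \<in> carrier_vec m" "0\<^sub>v m \<le> v"
    by (auto simp: v_def less_eq_vec_def)
  define C D where "C = Q * R" and "D = - (Q * S)"
  have C: "C \<in> carrier_mat n n" "0\<^sub>m n n \<le> C" and D: "D \<in> carrier_mat n n" "0\<^sub>m n n \<le> D"
    using Q(1) spl(2,3) regD(5,6) by (auto simp: C_def D_def Q_def)
  \<comment> \<open>With \<open>G = C + D\<close> one has \<open>x = G x + Q v\<close>, while \<open>G x\<close> is dominated by a multiple of \<open>Q v\<close>;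
    hence \<open>G x \<le> s\<^sup>2 x\<close> for some \<open>s < 1\<close>.\<close>
  define x where "x = mp_inv A *\<^sub>v v"
  note Ad = mp_inv[OF A]
  have x: "x \<in> carrier_vec n" "0\<^sub>v n \<le> x"
    using mult_mat_vec_nonneg[OF Ad(1) A0 v] mult_mat_vec_carrier[OF Ad(1) v(1)] by (simp_all add: x_def)
  have Cw: "C *\<^sub>v w = Q *\<^sub>v (R *\<^sub>v w)" and Dw: "D *\<^sub>v w = Q *\<^sub>v (- S *\<^sub>v w)"
    if "w \<in> carrier_vec n" for w
  proof -
    show "C *\<^sub>v w = Q *\<^sub>v (R *\<^sub>v w)"
      unfolding C_def by (rule assoc_mult_mat_vec[OF Q(1) spl(2) that])
    have "D = Q * - S"
      unfolding D_def using Q(1) spl(3) by simp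
    then show "D *\<^sub>v w = Q *\<^sub>v (- S *\<^sub>v w)"
      using assoc_mult_mat_vec[OF Q(1) _ that, of "- S"] spl(3) by simp
  qed
  \<comment> \<open>\<open>Q * P\<close> is the projector \<open>mp_inv A * A\<close>, and
    \<open>x\<close> lies in the range of \<open>mp_inv A\<close>, on which it is the
    identity.\<close>
  have fixed: "Q *\<^sub>v (P *\<^sub>v x) = x"
  proof -
    have "Q *\<^sub>v (P *\<^sub>v x) = mp_inv A * A *\<^sub>v (mp_inv A *\<^sub>v v)"
      using assoc_mult_mat_vec[OF Q(1) spl(1) x(1)] spl(5) by (simp add: Q_def x_def)
    also have "\<dots> = mp_inv A * A * mp_inv A *\<^sub>v v"
      by (rule assoc_mult_mat_vec[OF mult_carrier_mat[OF Ad(1) A] Ad(1) v(1), symmetric])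
    finally show ?thesis
      unfolding Ad(3) x_def .
  qed
  have QAx: "Q *\<^sub>v (A *\<^sub>v x) = Q *\<^sub>v v"
  proof -
    have "A *\<^sub>v x = P * Q *\<^sub>v v"
      unfolding x_def Q_def spl(6) by (rule assoc_mult_mat_vec[OF A Ad(1) v(1), symmetric])
    then have "Q *\<^sub>v (A *\<^sub>v x) = Q * (P * Q) *\<^sub>v v"
      using assoc_mult_mat_vec[OF Q(1) mult_carrier_mat[OF spl(1) Q(1)] v(1)] by simp
    also have "Q * (P * Q) = Q"
      using assoc_mult_mat[OF Q(1) spl(1) Q(1)] mp_inv(3)[OF spl(1)] by (simp add: Q_def)
    finally show ?thesis .
  qed
  have x_eq: "x $ i = (C *\<^sub>v x) $ i + (D *\<^sub>v x) $ i + (Q *\<^sub>v v) $ i" if i: "i < n" for i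
  proof -
    have "Q *\<^sub>v v = x - Q *\<^sub>v (R *\<^sub>v x) + Q *\<^sub>v (S *\<^sub>v x)"
      using mult_splitting_vec[OF A regD(1) Q(1) x(1)] QAx fixed by simp
    moreover have "D *\<^sub>v x = - (Q *\<^sub>v (S *\<^sub>v x))"
      unfolding D_def using Q(1) spl(3) x by simp
    ultimately show ?thesis
      using Cw[OF x(1)] i Q(1) spl by (simp del: index_mult_mat_vec)
  qed
  have nonneg: "0 \<le> (C *\<^sub>v x) $ i" "0 \<le> (D *\<^sub>v x) $ i" if "i < n" for i
    using mult_mat_vec_nonneg[OF C x] mult_mat_vec_nonneg[OF D x] that C D
    unfolding less_eq_vec_def by (auto simp del: index_mult_mat_vec)
  have Qv: "Q *\<^sub>v v \<in> carrier_vec n" "0\<^sub>v n \<le> Q *\<^sub>v v"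
    using mult_mat_vec_nonneg[OF Q v] mult_mat_vec_carrier[OF Q(1) v(1)] by auto
  \<comment> \<open>\<open>C x + D x\<close> is the image of \<open>z\<close> under
    \<open>Q\<close>, so a multiple \<open>t\<close> of \<open>Q v\<close> dominates it.\<close>
  define z where "z = R *\<^sub>v x + - S *\<^sub>v x"
  have Rx: "R *\<^sub>v x \<in> carrier_vec m" "- S *\<^sub>v x \<in> carrier_vec m"
    using spl(2,3) x(1) by (auto intro!: mult_mat_vec_carrier[of _ m n])
  have "C *\<^sub>v x + D *\<^sub>v x = Q *\<^sub>v z"
    unfolding z_def Cw[OF x(1)] Dw[OF x(1)] by (rule mult_add_distrib_mat_vec[OF Q(1) Rx, symmetric])
  moreover have "\<exists>t. Q *\<^sub>v z \<le> t \<cdot>\<^sub>v (Q *\<^sub>v v)"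
    using Qv Rx by (intro mult_vec_dominated[OF Q, where c = 1]) (auto simp: z_def v_def)
  ultimately obtain t where t: "C *\<^sub>v x + D *\<^sub>v x \<le> t \<cdot>\<^sub>v (Q *\<^sub>v v)"
    by auto
  \<comment> \<open>The bound \<open>t' \<ge> 1\<close> makes \<open>s\<close> positive. With
    \<open>g = C x + D x\<close>, the value of \<open>s\<close> is the one for which
    \<open>g \<le> t' (x - g)\<close> rearranges to \<open>g \<le> s^2 x\<close>.\<close>
  define t' where "t' = max t 1"
  define s where "s = sqrt (t' / (1 + t'))"
  have t': "t' \<ge> 1" "t' \<ge> t"
    by (auto simp: t'_def)
  have s: "0 < s" "s < 1" "s\<^sup>2 = t' / (1 + t')"
    using t' by (auto simp: s_def)
  have bound: "(C *\<^sub>v x) $ i + (D *\<^sub>v x) $ i \<le> s\<^sup>2 * x $ i" if i: "i < n" for i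
  proof -
    let ?g = "(C *\<^sub>v x) $ i + (D *\<^sub>v x) $ i"
    have "?g \<le> t * (Q *\<^sub>v v) $ i"
      using t i C D Q unfolding less_eq_vec_def by (auto simp del: index_mult_mat_vec)
    also have "\<dots> \<le> t' * (Q *\<^sub>v v) $ i"
      using t' Qv i unfolding less_eq_vec_def by (intro mult_right_mono) auto
    also have "\<dots> = t' * (x $ i - ?g)"
      using x_eq[OF i] by simp
    finally have "?g * (1 + t') \<le> t' * x $ i"
      by (simp add: algebra_simps)
    then show ?thesis
      unfolding s(3) using t' by (simp add: field_simps)
  qed
  have Qv_le: "Q *\<^sub>v vec m (\<lambda>_. 1) \<le> 1 \<cdot>\<^sub>v x"
    using x_eq nonneg x(1) Qv(1) Q(1) unfolding v_def[symmetric] less_eq_vec_def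
    by (auto simp del: index_mult_mat_vec)
  have dom: "\<exists>t. Q *\<^sub>v y \<le> t \<cdot>\<^sub>v x" if "y \<in> carrier_vec m" for y
    by (rule mult_vec_dominated[OF Q that x(1) Qv_le])
  have "rho (companion n C D) \<le> s"
  proof (rule rho_companion_le[OF n C D x s(1)])
    show "s * (C *\<^sub>v x) $ i + (D *\<^sub>v x) $ i \<le> s\<^sup>2 * x $ i" if i: "i < n" for i
    proof -
      have "s * (C *\<^sub>v x) $ i \<le> (C *\<^sub>v x) $ i"
        using nonneg[OF i] s by (intro mult_left_le_one_le) auto
      then show ?thesis
        using bound[OF i] by linarith
    qed
    show "\<exists>t. C *\<^sub>v w \<le> t \<cdot>\<^sub>v x" if "w \<in> carrier_vec n" for w
      unfolding Cw[OF that] by (intro dom mult_mat_vec_carrier[OF spl(2) that])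
    show "\<exists>t. D *\<^sub>v w \<le> t \<cdot>\<^sub>v x" if "w \<in> carrier_vec n" for w
      unfolding Dw[OF that] using spl(3) by (intro dom mult_mat_vec_carrier[OF _ that]) simp
  qed
  then show ?thesis
    using s(2) by (simp add: C_def D_def Q_def)
qed

text \<open>With \<open>Z = mp_inv P1\<close> and \<open>Q = mp_inv P2\<close>, the splittings
  interact through the shared projectors \<open>P2 * Q = P1 * Z\<close> and
  \<open>Z * P1 = Q * P2\<close>. The range and null space conditions let \<open>R2\<close> absorb
  the first on its left and the second on its right.\<close>

lemma rho_alternating_le:
  assumes n: "n > 0" and A: "A \<in> carrier_mat m n"
    and weak: "double_proper_weak_regular A P1 R1 S1"
    and reg: "double_proper_regular A P2 R2 S2"
    and null: "null_mat P2 \<subseteq> null_mat R2" and range: "range_mat R2 \<subseteq> range_mat P2"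
    and le: "mp_inv P2 * R2 + mp_inv P2 * S2 \<le> 0\<^sub>m n n"
    and lt1: "rho (companion n (mp_inv P2 * R2) (- (mp_inv P2 * S2))) < 1"
  shows "rho (companion n (mp_inv P2 * R2 * mp_inv P1 * R1 - mp_inv P2 * S2) (- (mp_inv P2 * R2 * mp_inv P1 * S1)))
    \<le> rho (companion n (mp_inv P2 * R2) (- (mp_inv P2 * S2)))"
proof -
  note regD = double_proper_regularD[OF A reg]
  note spl2 = double_proper_splittingD[OF A regD(1)]
  have spl1': "double_proper_splitting A P1 R1 S1"
    using weak unfolding double_proper_weak_regular_def by simp
  note spl1 = double_proper_splittingD[OF A spl1']
  define Z Q where "Z = mp_inv P1" and "Q = mp_inv P2"
  have Z: "Z \<in> carrier_mat n m" "0\<^sub>m n m \<le> Z" and Q: "Q \<in> carrier_mat n m" "0\<^sub>m n m \<le> Q"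
    using spl1(4) spl2(4) regD(2) weak A
    unfolding Z_def Q_def double_proper_weak_regular_def mat_le_iff by auto
  define a1 b1 a2 b2 where "a1 = Z * R1" and "b1 = - (Z * S1)" and "a2 = Q * R2" and "b2 = - (Q * S2)"
  have "Z * S1 \<le> 0\<^sub>m n n"
    using weak A unfolding Z_def double_proper_weak_regular_def mat_le_iff by auto
  then have b1: "b1 \<in> carrier_mat n n" "0\<^sub>m n n \<le> b1"
    using Z(1) spl1(3) unfolding b1_def less_eq_mat_def by auto
  have a1: "a1 \<in> carrier_mat n n" "0\<^sub>m n n \<le> a1"
    using weak A Z(1) spl1(2) unfolding a1_def Z_def double_proper_weak_regular_def mat_le_iff by auto
  have a2: "a2 \<in> carrier_mat n n" "0\<^sub>m n n \<le> a2" and b2: "b2 \<in> carrier_mat n n" "0\<^sub>m n n \<le> b2"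
    using Q(1) spl2(2,3) regD(5,6) by (auto simp: a2_def b2_def Q_def)
  have QS: "Q * S2 \<in> carrier_mat n n"
    using Q(1) spl2(3) by simp
  have a2_le_b2: "a2 \<le> b2"
    unfolding less_eq_mat_def
  proof (intro conjI allI impI)
    fix i j assume "i < dim_row b2" "j < dim_col b2"
    then have ij: "i < n" "j < n"
      using b2(1) by auto
    have "(a2 + Q * S2) $$ (i,j) \<le> 0"
      using le ij QS a2(1) unfolding Q_def[symmetric] a2_def[symmetric] less_eq_mat_def by auto
    then show "a2 $$ (i,j) \<le> b2 $$ (i,j)"
      unfolding b2_def using ij a2(1) carrier_matD[OF QS] by (simp del: index_mult_mat)
  qed (use a2 b2 in auto)
  define v where "v = vec m (\<lambda>_. 1 :: real)"
  have v: "v \<in> carrier_vec m" "0\<^sub>v m \<le> v"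
    by (auto simp: v_def less_eq_vec_def)
  define u where "u = Q *\<^sub>v v"
  have u: "u \<in> carrier_vec n" "0\<^sub>v n \<le> u"
    using mult_mat_vec_nonneg[OF Q v] mult_mat_vec_carrier[OF Q(1) v(1)] by (auto simp: u_def)
  define C D where "C = Q * R2 * Z * R1 - Q * S2" and "D = - (Q * R2 * Z * S1)"
  have a2Z: "Q * R2 * Z \<in> carrier_mat n m"
    using a2(1) Z(1) unfolding a2_def by simp
  have CD_eq: "C = a2 * a1 + b2" "D = a2 * b1"
  proof -
    have aa: "a2 * Z * R1 = a2 * a1" "a2 * Z * S1 = a2 * (Z * S1)"
      unfolding a1_def using a2(1) Z(1) spl1(2,3) by (auto intro!: assoc_mult_mat)
    show "C = a2 * a1 + b2"
      unfolding C_def b2_def a2_def[symmetric] aa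
      by (rule minus_add_uminus_mat[OF mult_carrier_mat[OF a2(1) a1(1)] QS])
    show "D = a2 * b1"
      unfolding D_def b1_def a2_def[symmetric] aa using a2(1) Z(1) spl1(3) by simp
  qed
  have C: "C \<in> carrier_mat n n" "0\<^sub>m n n \<le> C" and D: "D \<in> carrier_mat n n" "0\<^sub>m n n \<le> D"
  proof -
    show "C \<in> carrier_mat n n" "D \<in> carrier_mat n n" and "0\<^sub>m n n \<le> D"
      unfolding CD_eq using a1(1) a2(1) b1(1) b2(1) mult_mat_nonneg[OF a2(1) b1(1) a2(2) b1(2)] by auto
    show "0\<^sub>m n n \<le> C"
      unfolding CD_eq using mult_mat_nonneg[OF a2(1) a1(1) a2(2) a1(2)] b2 a2(1) a1(1)
      unfolding less_eq_mat_def by (auto simp del: index_mult_mat(1))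
  qed
  have mv: "a2 *\<^sub>v w = Q *\<^sub>v (R2 *\<^sub>v w)" "b2 *\<^sub>v w = Q *\<^sub>v (- S2 *\<^sub>v w)"
    "a1 *\<^sub>v w = Z *\<^sub>v (R1 *\<^sub>v w)" "b1 *\<^sub>v w = - (Z *\<^sub>v (S1 *\<^sub>v w))"
    "C *\<^sub>v w = a2 *\<^sub>v (a1 *\<^sub>v w) + b2 *\<^sub>v w" "D *\<^sub>v w = a2 *\<^sub>v (b1 *\<^sub>v w)"
    if w: "w \<in> carrier_vec n" for w
  proof -
    show "a2 *\<^sub>v w = Q *\<^sub>v (R2 *\<^sub>v w)"
      unfolding a2_def by (rule assoc_mult_mat_vec[OF Q(1) spl2(2) w])
    show "a1 *\<^sub>v w = Z *\<^sub>v (R1 *\<^sub>v w)"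
      unfolding a1_def by (rule assoc_mult_mat_vec[OF Z(1) spl1(2) w])
    show "b1 *\<^sub>v w = - (Z *\<^sub>v (S1 *\<^sub>v w))"
      unfolding b1_def using Z(1) spl1(3) w by simp
    have "b2 = Q * - S2"
      unfolding b2_def using Q(1) spl2(3) by simp
    then show "b2 *\<^sub>v w = Q *\<^sub>v (- S2 *\<^sub>v w)"
      using assoc_mult_mat_vec[OF Q(1) _ w, of "- S2"] spl2(3) by simp
    show "D *\<^sub>v w = a2 *\<^sub>v (b1 *\<^sub>v w)"
      unfolding CD_eq by (rule assoc_mult_mat_vec[OF a2(1) b1(1) w])
    show "C *\<^sub>v w = a2 *\<^sub>v (a1 *\<^sub>v w) + b2 *\<^sub>v w"
      unfolding CD_eq assoc_mult_mat_vec[OF a2(1) a1(1) w, symmetric]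
      by (rule add_mult_distrib_mat_vec[OF mult_carrier_mat[OF a2(1) a1(1)] b2(1) w])
  qed
  have carr: "X *\<^sub>v w \<in> carrier_vec k" if "X \<in> carrier_mat k l" "w \<in> carrier_vec l" for X :: "real mat" and w k l
    by (rule mult_mat_vec_carrier[OF that])
  \<comment> \<open>The projector \<open>P2 * Q\<close> fixes \<open>R2\<close> by the range
    hypothesis and also fixes \<open>A\<close> and \<open>P2\<close>; the splitting equation then
    transfers this to \<open>S2\<close>.\<close>
  have PQR: "P2 *\<^sub>v (Q *\<^sub>v (R2 *\<^sub>v w)) = R2 *\<^sub>v w" and PQS: "P2 *\<^sub>v (Q *\<^sub>v (S2 *\<^sub>v w)) = S2 *\<^sub>v w"
    if w: "w \<in> carrier_vec n" for w
  proof -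
    have PQ: "P2 * Q \<in> carrier_mat m m"
      using spl2(1) Q(1) by simp
    have "P2 *\<^sub>v (Q *\<^sub>v y) = P2 * Q *\<^sub>v y" if "y \<in> carrier_vec m" for y
      by (rule assoc_mult_mat_vec[OF spl2(1) Q(1) that, symmetric])
    moreover have fix_range: "P2 * Q *\<^sub>v (B *\<^sub>v w) = B *\<^sub>v w"
      if B: "B \<in> carrier_mat m n" and BP: "P2 * Q * B = B" for B
      using assoc_mult_mat_vec[OF PQ B w] BP by simp
    moreover have "P2 * Q * R2 = R2"
      unfolding Q_def by (rule mult_mp_inv_absorb_left[OF spl2(1,2) range])
    moreover have "P2 * Q * P2 = P2"
      unfolding Q_def by (rule mp_inv(2)[OF spl2(1)])
    moreover have "P2 * Q * A = A"
      using mult_mp_inv_absorb_left[OF A A] by (simp add: Q_def spl2(6))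
    ultimately have R: "P2 *\<^sub>v (Q *\<^sub>v (R2 *\<^sub>v w)) = R2 *\<^sub>v w"
      and P: "P2 *\<^sub>v (Q *\<^sub>v (P2 *\<^sub>v w)) = P2 *\<^sub>v w" and A': "P2 *\<^sub>v (Q *\<^sub>v (A *\<^sub>v w)) = A *\<^sub>v w"
      using A spl2(1,2) carr[OF spl2(2) w] carr[OF spl2(1) w] carr[OF A w] by simp_all
    show "P2 *\<^sub>v (Q *\<^sub>v (R2 *\<^sub>v w)) = R2 *\<^sub>v w"
      by (rule R)
    have c: "Q *\<^sub>v (P2 *\<^sub>v w) \<in> carrier_vec n" "Q *\<^sub>v (R2 *\<^sub>v w) \<in> carrier_vec n" "Q *\<^sub>v (S2 *\<^sub>v w) \<in> carrier_vec n"
      by (rule carr[OF Q(1) carr[OF spl2(1) w]] carr[OF Q(1) carr[OF spl2(2) w]] carr[OF Q(1) carr[OF spl2(3) w]])+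
    have "A *\<^sub>v w = P2 *\<^sub>v w - R2 *\<^sub>v w + P2 *\<^sub>v (Q *\<^sub>v (S2 *\<^sub>v w))"
      using arg_cong[OF mult_splitting_vec[OF A regD(1) Q(1) w], of "\<lambda>y. P2 *\<^sub>v y"] c
      by (simp add: A' P R mult_add_distrib_mat_vec[OF spl2(1)] mult_minus_distrib_mat_vec[OF spl2(1)])
    then have "P2 *\<^sub>v w - R2 *\<^sub>v w + P2 *\<^sub>v (Q *\<^sub>v (S2 *\<^sub>v w)) = P2 *\<^sub>v w - R2 *\<^sub>v w + S2 *\<^sub>v w"
      using spl2(7)[OF w] by simp
    then show "P2 *\<^sub>v (Q *\<^sub>v (S2 *\<^sub>v w)) = S2 *\<^sub>v w"
      using spl2(1-3) by (auto simp: vec_eq_iff simp del: index_mult_mat_vec)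
  qed
  have ZPQ: "Z *\<^sub>v (P2 *\<^sub>v u) = Z *\<^sub>v v"
  proof -
    have "P2 * Q = P1 * Z"
      unfolding Q_def Z_def spl1(6) spl2(6) ..
    then have "P2 *\<^sub>v u = P1 * Z *\<^sub>v v"
      unfolding u_def using assoc_mult_mat_vec[OF spl2(1) Q(1) v(1)] by simp
    then have "Z *\<^sub>v (P2 *\<^sub>v u) = Z * (P1 * Z) *\<^sub>v v"
      using assoc_mult_mat_vec[OF Z(1) mult_carrier_mat[OF spl1(1) Z(1)] v(1)] by simp
    also have "Z * (P1 * Z) = Z"
      using assoc_mult_mat[OF Z(1) spl1(1) Z(1)] mp_inv(3)[OF spl1(1)] by (simp add: Z_def)
    finally show ?thesis .
  qed
  have a2ZP: "a2 *\<^sub>v (Z *\<^sub>v (P1 *\<^sub>v w)) = a2 *\<^sub>v w" if w: "w \<in> carrier_vec n" for w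
  proof -
    have ZP: "Z * P1 \<in> carrier_mat n n"
      using Z(1) spl1(1) by simp
    have "a2 *\<^sub>v (Z *\<^sub>v (P1 *\<^sub>v w)) = a2 * (Z * P1) *\<^sub>v w"
      using assoc_mult_mat_vec[OF Z(1) spl1(1) w] assoc_mult_mat_vec[OF a2(1) ZP w] by simp
    also have "a2 * (Z * P1) = Q * (R2 * (Z * P1))"
      unfolding a2_def by (rule assoc_mult_mat[OF Q(1) spl2(2) ZP])
    also have "Z * P1 = Q * P2"
      unfolding Q_def Z_def spl1(5) spl2(5) ..
    also have "R2 * (Q * P2) = R2"
      unfolding Q_def by (rule mult_mp_inv_absorb_right[OF spl2(1,2) null])
    finally show ?thesis
      by (simp add: a2_def)
  qed
  have main: "rho (companion n C D) \<le> s" if s: "rho (companion n a2 b2) < s" "s < 1" for s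
  proof -
    have s0: "0 < s"
      using rho_nonneg[OF companion_carrier[OF a2(1), of b2]] n s by simp
    obtain x where x: "x \<in> carrier_vec n" "0\<^sub>v n \<le> x"
      and eq: "s\<^sup>2 \<cdot>\<^sub>v x = s \<cdot>\<^sub>v (a2 *\<^sub>v x) + b2 *\<^sub>v x + u"
      using companion_resolvent_nonneg[OF n a2 b2 s(1) u] by blast
    \<comment> \<open>The defining equation of \<open>x\<close> exhibits \<open>s\<^sup>2 P2 x\<close> as a nonnegative combination modulo
      the kernel of \<open>Z\<close>, which makes \<open>g\<close> nonnegative, although neither \<open>A x\<close> nor \<open>Z P2\<close> need be.\<close>
    define g where "g = Z *\<^sub>v (A *\<^sub>v x)"
    have g: "g \<in> carrier_vec n"
      unfolding g_def by (intro carr[OF Z(1)] carr[OF A] x)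
    have nn: "0 \<le> (X *\<^sub>v y) $ i" if "X \<in> carrier_mat k l" "0\<^sub>m k l \<le> X" "y \<in> carrier_vec l" "0\<^sub>v l \<le> y" "i < k"
      for X :: "real mat" and y i k l
      using mult_mat_vec_nonneg[OF that(1-4)] that(1,5) unfolding less_eq_vec_def by auto
    have P2x: "s\<^sup>2 \<cdot>\<^sub>v (P2 *\<^sub>v x) = s \<cdot>\<^sub>v (R2 *\<^sub>v x) + - (S2 *\<^sub>v x) + P2 *\<^sub>v u"
    proof -
      have "- S2 *\<^sub>v x = - (S2 *\<^sub>v x)"
        using spl2(3) x by simp
      then have "b2 *\<^sub>v x = - (Q *\<^sub>v (S2 *\<^sub>v x))"
        unfolding b2_def using Q(1) spl2(3) x by simp
      moreover have "P2 *\<^sub>v - (Q *\<^sub>v (S2 *\<^sub>v x)) = - (P2 *\<^sub>v (Q *\<^sub>v (S2 *\<^sub>v x)))"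
        using carr[OF Q(1) carr[OF spl2(3) x(1)]] by (rule mult_mat_vec_uminus[OF spl2(1)])
      ultimately have b2x: "P2 *\<^sub>v (b2 *\<^sub>v x) = - (S2 *\<^sub>v x)"
        using PQS[OF x(1)] by simp
      have a2x: "P2 *\<^sub>v (a2 *\<^sub>v x) = R2 *\<^sub>v x"
        using PQR[OF x(1)] mv(1)[OF x(1)] by simp
      have "s\<^sup>2 \<cdot>\<^sub>v (P2 *\<^sub>v x) = P2 *\<^sub>v (s \<cdot>\<^sub>v (a2 *\<^sub>v x) + b2 *\<^sub>v x + u)"
        unfolding eq[symmetric] by (rule mult_mat_vec[OF spl2(1) x(1), symmetric])
      also have "\<dots> = s \<cdot>\<^sub>v (P2 *\<^sub>v (a2 *\<^sub>v x)) + P2 *\<^sub>v (b2 *\<^sub>v x) + P2 *\<^sub>v u"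
        using carr[OF a2(1) x(1)] carr[OF b2(1) x(1)] u(1)
        by (simp add: mult_add_distrib_mat_vec[OF spl2(1)] mult_mat_vec[OF spl2(1)] del: assoc_add_vec)
      finally show ?thesis
        unfolding a2x b2x .
    qed
    have g_nonneg: "0 \<le> g $ i" if i: "i < n" for i
    proof -
      define p r q where "p = (Z *\<^sub>v (P2 *\<^sub>v x)) $ i" and "r = (Z *\<^sub>v (R2 *\<^sub>v x)) $ i"
        and "q = (Z *\<^sub>v (- S2 *\<^sub>v x)) $ i"
      have c: "P2 *\<^sub>v x \<in> carrier_vec m" "R2 *\<^sub>v x \<in> carrier_vec m" "S2 *\<^sub>v x \<in> carrier_vec m" "P2 *\<^sub>v u \<in> carrier_vec m"
        by (rule carr[OF spl2(1) x(1)] carr[OF spl2(2) x(1)] carr[OF spl2(3) x(1)] carr[OF spl2(1) u(1)])+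
      have S: "- S2 *\<^sub>v x = - (S2 *\<^sub>v x)"
        using spl2(3) x by simp
      have Zneg: "Z *\<^sub>v - (S2 *\<^sub>v x) = - (Z *\<^sub>v (S2 *\<^sub>v x))"
        by (rule mult_mat_vec_uminus[OF Z(1) c(3)])
      have rq: "0 \<le> r" "0 \<le> q" "0 \<le> (Z *\<^sub>v v) $ i"
        unfolding r_def q_def
        using nn[OF Z c(2) mult_mat_vec_nonneg[OF spl2(2) regD(3) x] i]
          nn[OF Z _ mult_mat_vec_nonneg[OF _ regD(4) x] i] nn[OF Z v i] spl2(3) c(3) S by auto
      \<comment> \<open>Here \<open>A\<close> is expanded by the second splitting, whereas
        \<open>a2g\<close> expands the same \<open>g\<close> by the first. Eliminating
        \<open>p\<close> through \<open>sp\<close> leaves the coefficients \<open>s - s^2\<close>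
        and \<open>1 - s^2\<close>, nonnegative because \<open>0 < s < 1\<close>.\<close>
      have gi: "g $ i = p - r - q"
        unfolding g_def mult_splitting_vec[OF A regD(1) Z(1) x(1)] p_def r_def q_def S Zneg
        using i Z(1) by (simp del: index_mult_mat_vec)
      have sp: "s\<^sup>2 * p = s * r + q + (Z *\<^sub>v v) $ i"
      proof -
        have "s\<^sup>2 \<cdot>\<^sub>v (Z *\<^sub>v (P2 *\<^sub>v x)) = Z *\<^sub>v (s \<cdot>\<^sub>v (R2 *\<^sub>v x) + - (S2 *\<^sub>v x) + P2 *\<^sub>v u)"
          unfolding P2x[symmetric] by (rule mult_mat_vec[OF Z(1) c(1), symmetric])
        also have "\<dots> = s \<cdot>\<^sub>v (Z *\<^sub>v (R2 *\<^sub>v x)) + Z *\<^sub>v (- S2 *\<^sub>v x) + Z *\<^sub>v v"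
          using c by (simp add: mult_add_distrib_mat_vec[OF Z(1)] mult_mat_vec[OF Z(1)] S ZPQ del: assoc_add_vec)
        finally have "(s\<^sup>2 \<cdot>\<^sub>v (Z *\<^sub>v (P2 *\<^sub>v x))) $ i
            = (s \<cdot>\<^sub>v (Z *\<^sub>v (R2 *\<^sub>v x)) + Z *\<^sub>v (- S2 *\<^sub>v x) + Z *\<^sub>v v) $ i"
          by simp
        then show ?thesis
          using i Z(1) unfolding p_def q_def r_def by (simp del: index_mult_mat_vec)
      qed
      have "s\<^sup>2 * g $ i = (s - s\<^sup>2) * r + (1 - s\<^sup>2) * q + (Z *\<^sub>v v) $ i"
        unfolding gi right_diff_distrib sp by (simp add: algebra_simps)
      also have "\<dots> \<ge> 0"
        using rq s0 s by (intro add_nonneg_nonneg mult_nonneg_nonneg) (auto simp: power2_eq_square mult_le_one)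
      finally show ?thesis
        using s0 by (simp add: zero_le_mult_iff)
    qed
    \<comment> \<open>The first splitting gives \<open>g = Z P1 x - a1 x - b1 x\<close>, and
      \<open>a2\<close> absorbs the projector \<open>Z * P1\<close>.\<close>
    have a2g: "a2 *\<^sub>v g = a2 *\<^sub>v x - a2 *\<^sub>v (a1 *\<^sub>v x) - a2 *\<^sub>v (b1 *\<^sub>v x)"
    proof -
      have c: "Z *\<^sub>v (P1 *\<^sub>v x) \<in> carrier_vec n" "a1 *\<^sub>v x \<in> carrier_vec n" "b1 *\<^sub>v x \<in> carrier_vec n"
        "Z *\<^sub>v (S1 *\<^sub>v x) \<in> carrier_vec n"
        by (rule carr[OF Z(1) carr[OF spl1(1) x(1)]] carr[OF a1(1) x(1)] carr[OF b1(1) x(1)]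
            carr[OF Z(1) carr[OF spl1(3) x(1)]])+
      have "g = Z *\<^sub>v (P1 *\<^sub>v x) - a1 *\<^sub>v x - b1 *\<^sub>v x"
        unfolding g_def mult_splitting_vec[OF A spl1' Z(1) x(1)] mv(3)[OF x(1)] mv(4)[OF x(1)]
        using Z(1) by (intro eq_vecI) auto
      then show ?thesis
        using c a2ZP[OF x(1)] by (simp add: mult_minus_distrib_mat_vec[OF a2(1)])
    qed
    \<comment> \<open>The chain is
      \<open>s ga + de + s be \<le> al + s be \<le> s al + be \<le> s^2 x\<close>: first
      \<open>s \<le> 1\<close> and \<open>a2 g \<ge> 0\<close>, then
      \<open>(1 - s) al \<le> (1 - s) be\<close> from \<open>a2 \<le> b2\<close>, and finally the
      equation for \<open>x\<close> with \<open>u \<ge> 0\<close>.\<close>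
    have sub: "s * (C *\<^sub>v x) $ i + (D *\<^sub>v x) $ i \<le> s\<^sup>2 * x $ i" if i: "i < n" for i
    proof -
      have g0: "0\<^sub>v n \<le> g"
        using g g_nonneg unfolding less_eq_vec_def by auto
      define al be ga de where "al = (a2 *\<^sub>v x) $ i" and "be = (b2 *\<^sub>v x) $ i"
        and "ga = (a2 *\<^sub>v (a1 *\<^sub>v x)) $ i" and "de = (a2 *\<^sub>v (b1 *\<^sub>v x)) $ i"
      have "0 \<le> (a2 *\<^sub>v g) $ i"
        by (rule nn[OF a2 g g0 i])
      then have 1: "ga + de \<le> al"
        unfolding a2g al_def ga_def de_def using i a2(1) by (simp del: index_mult_mat_vec)
      have 2: "0 \<le> ga"
        unfolding ga_def by (rule nn[OF a2 carr[OF a1(1) x(1)] mult_mat_vec_nonneg[OF a1 x] i])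
      have 3: "al \<le> be"
        using mult_mat_vec_mono_left[OF b2(1) a2_le_b2 x] i b2(1) unfolding less_eq_vec_def al_def be_def by auto
      have 4: "0 \<le> u $ i"
        using u i unfolding less_eq_vec_def by auto
      have 5: "s\<^sup>2 * x $ i = s * al + be + u $ i"
        using arg_cong[OF eq, of "\<lambda>y. y $ i"] i x(1) u(1) a2(1) b2(1) unfolding al_def be_def
        by (simp del: index_mult_mat_vec)
      have 6: "s * (C *\<^sub>v x) $ i + (D *\<^sub>v x) $ i = s * ga + s * be + de"
        unfolding mv(5)[OF x(1)] mv(6)[OF x(1)] ga_def be_def de_def
        using i a2(1) b2(1) by (simp add: distrib_left del: index_mult_mat_vec)
      have "s * ga \<le> ga"
        using 2 s s0 by (intro mult_left_le_one_le) auto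
      moreover have "(1 - s) * al \<le> (1 - s) * be"
        using 3 s by (intro mult_left_mono) auto
      ultimately show ?thesis
        unfolding 5 6 using 1 4 by (simp add: algebra_simps)
    qed
    \<comment> \<open>The nonnegative terms with \<open>a2\<close> and \<open>b2\<close> are dropped
      from the equation for \<open>x\<close>. Since \<open>C w\<close> and \<open>D w\<close> are
      both images under \<open>Q\<close>, this gives their domination by \<open>x\<close>.\<close>
    have Qv_le: "Q *\<^sub>v vec m (\<lambda>_. 1) \<le> s\<^sup>2 \<cdot>\<^sub>v x"
      unfolding v_def[symmetric] u_def[symmetric] less_eq_vec_def
    proof (intro conjI allI impI)
      fix i assume "i < dim_vec (s\<^sup>2 \<cdot>\<^sub>v x)"
      then have i: "i < n"
        using x by simp
      have "0 \<le> (a2 *\<^sub>v x) $ i" "0 \<le> (b2 *\<^sub>v x) $ i"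
        using nn[OF a2 x i] nn[OF b2 x i] by auto
      then show "u $ i \<le> (s\<^sup>2 \<cdot>\<^sub>v x) $ i"
        unfolding eq using i u(1) a2(1) b2(1) s0 by (simp del: index_mult_mat_vec)
    qed (use u x in auto)
    have dom: "\<exists>t. Q *\<^sub>v y \<le> t \<cdot>\<^sub>v x" if "y \<in> carrier_vec m" for y
      by (rule mult_vec_dominated[OF Q that x(1) Qv_le])
    show ?thesis
    proof (rule rho_companion_le[OF n C D x s0 sub])
      show "\<exists>t. C *\<^sub>v w \<le> t \<cdot>\<^sub>v x" if w: "w \<in> carrier_vec n" for w
      proof -
        have c: "R2 *\<^sub>v (a1 *\<^sub>v w) \<in> carrier_vec m" "- S2 *\<^sub>v w \<in> carrier_vec m"
          using carr[OF spl2(2) carr[OF a1(1) w]] carr[of "- S2" m n w] spl2(3) w by auto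
        have "C *\<^sub>v w = Q *\<^sub>v (R2 *\<^sub>v (a1 *\<^sub>v w) + - S2 *\<^sub>v w)"
          unfolding mv(5)[OF w] mv(1)[OF carr[OF a1(1) w]] mv(2)[OF w]
          by (rule mult_add_distrib_mat_vec[OF Q(1) c, symmetric])
        then show ?thesis
          using dom c by simp
      qed
      show "\<exists>t. D *\<^sub>v w \<le> t \<cdot>\<^sub>v x" if w: "w \<in> carrier_vec n" for w
        unfolding mv(6)[OF w] mv(1)[OF carr[OF b1(1) w]]
        by (intro dom carr[OF spl2(2)] carr[OF b1(1)] w)
    qed
  qed
  \<comment> \<open>The estimate holds for \<open>s\<close> strictly between the radius and 1, an
    interval that is nonempty by \<open>lt1\<close>; letting \<open>s\<close> decrease gives the
    radius itself.\<close>
  have "rho (companion n C D) \<le> rho (companion n a2 b2)"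
  proof (rule dense_ge_bounded)
    show "rho (companion n a2 b2) < 1"
      using lt1 by (simp add: a2_def b2_def Q_def)
  qed (rule main)
  then show ?thesis
    unfolding C_def D_def a2_def b2_def Q_def Z_def .
qed

section \<open>Combination of the three spectral radius estimates\<close>

theorem theorem3p17:
  fixes A P1 R1 S1 P2 R2 S2 :: "real mat" and m n :: nat
  assumes "m > 0" and "n > 0"
    and "A \<in> carrier_mat m n"
    and "semi_monotone A"
    and "double_proper_weak_regular A P1 R1 S1"
    and "double_proper_regular A P2 R2 S2"
    and "null_mat P2 \<subseteq> null_mat R2"
    and "range_mat R2 \<subseteq> range_mat P2"
    and "- 1 \<notin> rspectrum (R2 * mp_inv P1)"
    and "mat_le (0\<^sub>m n m) (mp_inv ((1\<^sub>m m + R2 * mp_inv P1) * A))"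
    and "mat_le (mp_inv P2 * R2) (mp_inv P1 * R1)"
    and "mat_le (mp_inv P1 * S1) (mp_inv P2 * S2)"
    and "mat_le (mp_inv P2 * R2 + mp_inv P2 * S2) (0\<^sub>m n n)"
  shows "rho (four_block_mat
              (mp_inv P2 * R2 * mp_inv P1 * R1 - mp_inv P2 * S2) (- (mp_inv P2 * R2 * mp_inv P1 * S1))
              (1\<^sub>m n) (0\<^sub>m n n))
         \<le> min (rho (four_block_mat (mp_inv P1 * R1) (- (mp_inv P1 * S1)) (1\<^sub>m n) (0\<^sub>m n n)))
                (rho (four_block_mat (mp_inv P2 * R2) (- (mp_inv P2 * S2)) (1\<^sub>m n) (0\<^sub>m n n)))
       \<and> min (rho (four_block_mat (mp_inv P1 * R1) (- (mp_inv P1 * S1)) (1\<^sub>m n) (0\<^sub>m n n)))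
                (rho (four_block_mat (mp_inv P2 * R2) (- (mp_inv P2 * S2)) (1\<^sub>m n) (0\<^sub>m n n))) < 1"
proof -
  note n = assms(2) and A = assms(3) and weak = assms(5) and reg = assms(6)
  note regD = double_proper_regularD[OF A reg]
  note spl2 = double_proper_splittingD[OF A regD(1)]
  have spl1': "double_proper_splitting A P1 R1 S1"
    using weak unfolding double_proper_weak_regular_def by simp
  note spl1 = double_proper_splittingD[OF A spl1']
  let ?T1 = "companion n (mp_inv P1 * R1) (- (mp_inv P1 * S1))"
  let ?T2 = "companion n (mp_inv P2 * R2) (- (mp_inv P2 * S2))"
  have A0: "0\<^sub>m n m \<le> mp_inv A"
    using assms(4) A unfolding semi_monotone_def mat_le_iff by simp
  have T2: "rho ?T2 < 1"
    by (rule rho_double_proper_regular_less_one[OF n A A0 reg])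
  \<comment> \<open>With the sign change, the two comparison hypotheses order the upper blocks of
    \<open>?T2\<close> below those of \<open>?T1\<close>.\<close>
  have "- (mp_inv P2 * S2) \<le> - (mp_inv P1 * S1)"
    using assms(12) unfolding mat_le_iff less_eq_mat_def by (auto simp del: index_mult_mat(1))
  then have T21: "rho ?T2 \<le> rho ?T1"
    using assms(11) spl1 spl2 regD(5,6) unfolding mat_le_iff by (intro rho_companion_mono[OF n]) auto
  have "rho (companion n (mp_inv P2 * R2 * mp_inv P1 * R1 - mp_inv P2 * S2)
      (- (mp_inv P2 * R2 * mp_inv P1 * S1))) \<le> rho ?T2"
    using assms(7,8,13) unfolding mat_le_iff
    by (intro rho_alternating_le[OF n A weak reg _ _ _ T2]) auto
  then show ?thesis
    using T2 T21 by simp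
qed

end
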